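(* Let $n\ge4$. Neither the Keel presentation nor the De Concini--Procesi presentation of the ring $H^\bullet(\overline{\mathcal{M}}_{0,n+1},\mathbb{Z})$ admits a linear-and-quadratic Gröbner basis, either commutative or noncommutative, no matter what admissible ordering of monomials in the generators one chooses.
   Context: $\overline{\mathcal{M}}_{0,n+1}$ is the moduli space of stable rational curves with $n+1$ marked points; write $\underline{m}=\{1,\ldots,m\}$. Keel presentation of $H^\bullet(\overline{\mathcal{M}}_{0,n+1},\mathbb{Z})$: generators $D_S$ with $S\subset\underline{n+1}$, $2\le|S|\le n-1$; relations: $D_S=D_{\underline{n+1}\setminus S}$ for all $S$; $\sum_{i,j\in S,\,k,l\notin S}D_S=\sum_{i,k\in S,\,j,l\notin S}D_S=\sum_{i,l\in S,\,j,k\notin S}D_S$ for all pairwise distinct $i,j,k,l\in\underline{n+1}$; and $D_SD_T=0$ for all $S,T$ such that the four sets $S\cap T$, $S\setminus T$, $T\setminus S$, $\underline{n+1}\setminus(S\cup T)$ are all non-empty. De Concini--Procesi presentation: generators $Y_S$ with $S\subseteq\underline{n}$, $2\le|S|\le n$; relations: $\sum_{S\ni i,j}Y_S=0$ for all $i\ne j$ in $\underline{n}$; and $Y_SY_T=0$ for all $S,T$ with $S\cap T\ne\varnothing$, $S\not\subseteq T$, $T\not\subseteq S$. All generators have weight $1$. In the commutative case, a presentation is viewed as a quotient of the polynomial ring over $\mathbb{Z}$ in its generators by the ideal $I$ of all relations; in the noncommutative case, as a quotient of the free associative ring on the generators by the two-sided ideal $I$ of all relations (including the commutators of generators). An ordering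 of (commutative, respectively noncommutative) monomials is admissible if it is a total well ordering and the product of monomials is an increasing function of each argument. A Gröbner basis of $I$ for such an ordering is a subset $G\subset I$ such that the leading coefficient of every element of $G$ is $1$ and the leading monomial of every nonzero element of $I$ is divisible by the leading monomial of an element of $G$. A Gröbner basis is linear-and-quadratic if each of its elements is homogeneous of weight $1$ or $2$. *)

theory Defs
  imports "HOL-Library.Poly_Mapping"
begin

text \<open>
  Polynomial rings and free associative rings over the integers are both monoid rings
  \<open>'m \<Rightarrow>\<^sub>0 int\<close>: commutative monomials form the free commutative monoid \<open>'x \<Rightarrow>\<^sub>0 nat\<close>
  (exponent vectors), noncommutative ones the free monoid \<open>'x nc_monomial\<close> (words). The
  product of monomials is written additively, as required by \<^theory>\<open>HOL-Library.Poly_Mapping\<close>.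
\<close>

datatype 'x nc_monomial = NCMonomial (letters: "'x list")

instantiation nc_monomial :: (type) monoid_add
begin

definition zero_nc_monomial :: "'a nc_monomial"
  where "0 = NCMonomial []"

definition plus_nc_monomial :: "'a nc_monomial \<Rightarrow> 'a nc_monomial \<Rightarrow> 'a nc_monomial"
  where "u + v = NCMonomial (letters u @ letters v)"

instance
  by standard (simp_all add: zero_nc_monomial_def plus_nc_monomial_def)

end

definition comm_monomials :: "'x set \<Rightarrow> ('x \<Rightarrow>\<^sub>0 nat) set"
  where "comm_monomials X = {m. Poly_Mapping.keys m \<subseteq> X}"

definition comm_weight :: "('x \<Rightarrow>\<^sub>0 nat) \<Rightarrow> nat"
  where "comm_weight m = (\<Sum>x\<in>Poly_Mapping.keys m. Poly_Mapping.lookup m x)"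

definition comm_gen :: "'x \<Rightarrow> ('x \<Rightarrow>\<^sub>0 nat) \<Rightarrow>\<^sub>0 int"
  where "comm_gen x = Poly_Mapping.single (Poly_Mapping.single x 1) 1"

definition nc_monomials :: "'x set \<Rightarrow> 'x nc_monomial set"
  where "nc_monomials X = {m. set (letters m) \<subseteq> X}"

definition nc_weight :: "'x nc_monomial \<Rightarrow> nat"
  where "nc_weight m = length (letters m)"

definition nc_gen :: "'x \<Rightarrow> 'x nc_monomial \<Rightarrow>\<^sub>0 int"
  where "nc_gen x = Poly_Mapping.single (NCMonomial [x]) 1"

text \<open>
  Below, \<open>M\<close> is the submonoid of monomials in the chosen generators; the ring under
  consideration is \<open>polynomials M\<close>, not the whole type.
\<close>

definition polynomials :: "'m set \<Rightarrow> ('m \<Rightarrow>\<^sub>0 int) set"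
  where "polynomials M = {p. Poly_Mapping.keys p \<subseteq> M}"

inductive_set two_sided_ideal :: "'r::ring_1 set \<Rightarrow> 'r set \<Rightarrow> 'r set"
  for A R :: "'r set"
  where
    zero: "0 \<in> two_sided_ideal A R"
  | add: "p \<in> two_sided_ideal A R \<Longrightarrow> a \<in> A \<Longrightarrow> r \<in> R \<Longrightarrow> b \<in> A
      \<Longrightarrow> p + a * r * b \<in> two_sided_ideal A R"

definition admissible_ordering :: "'m::monoid_add set \<Rightarrow> 'm rel \<Rightarrow> bool"
  where "admissible_ordering M ord \<longleftrightarrow>
    well_order_on M ord \<and>
    (\<forall>u\<in>M. \<forall>v\<in>M. \<forall>w\<in>M. (u, v) \<in> ord \<and> u \<noteq> v \<longrightarrow>
      (w + u, w + v) \<in> ord \<and> w + u \<noteq> w + v \<and>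
      (u + w, v + w) \<in> ord \<and> u + w \<noteq> v + w)"

text \<open>Only meaningful for nonzero polynomials.\<close>

definition leading_monomial :: "'m rel \<Rightarrow> ('m \<Rightarrow>\<^sub>0 int) \<Rightarrow> 'm"
  where "leading_monomial ord p =
    (THE m. m \<in> Poly_Mapping.keys p \<and> (\<forall>k\<in>Poly_Mapping.keys p. (k, m) \<in> ord))"

definition leading_coeff :: "'m rel \<Rightarrow> ('m \<Rightarrow>\<^sub>0 int) \<Rightarrow> int"
  where "leading_coeff ord p = Poly_Mapping.lookup p (leading_monomial ord p)"

text \<open>In a commutative monoid the following is ordinary divisibility of monomials.\<close>

definition monomial_divides :: "'m::monoid_add set \<Rightarrow> 'm \<Rightarrow> 'm \<Rightarrow> bool"
  where "monomial_divides M m m' \<longleftrightarrow> (\<exists>u\<in>M. \<exists>v\<in>M. m' = u + m + v)"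

definition groebner_basis ::
  "'m::monoid_add set \<Rightarrow> 'm rel \<Rightarrow> ('m \<Rightarrow>\<^sub>0 int) set \<Rightarrow> ('m \<Rightarrow>\<^sub>0 int) set \<Rightarrow> bool"
  where "groebner_basis M ord I G \<longleftrightarrow>
    G \<subseteq> I \<and>
    (\<forall>g\<in>G. leading_coeff ord g = 1) \<and>
    (\<forall>f\<in>I. f \<noteq> 0 \<longrightarrow>
      (\<exists>g\<in>G. monomial_divides M (leading_monomial ord g) (leading_monomial ord f)))"

definition homogeneous :: "('m \<Rightarrow> nat) \<Rightarrow> nat \<Rightarrow> ('m \<Rightarrow>\<^sub>0 int) \<Rightarrow> bool"
  where "homogeneous wt d p \<longleftrightarrow> (\<forall>m\<in>Poly_Mapping.keys p. wt m = d)"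

definition linear_and_quadratic :: "('m \<Rightarrow> nat) \<Rightarrow> ('m \<Rightarrow>\<^sub>0 int) set \<Rightarrow> bool"
  where "linear_and_quadratic wt G \<longleftrightarrow> (\<forall>g\<in>G. homogeneous wt 1 g \<or> homogeneous wt 2 g)"

definition keel_generators :: "nat \<Rightarrow> nat set set"
  where "keel_generators n = {S. S \<subseteq> {1..n+1} \<and> 2 \<le> card S \<and> card S \<le> n - 1}"

text \<open>
  Relations are given for generators \<open>D S\<close> (resp. \<open>Y S\<close>) in an arbitrary ring, so that they
  can be used in both the commutative and the noncommutative setting.
\<close>

definition keel_relations :: "(nat set \<Rightarrow> 'r::ring_1) \<Rightarrow> nat \<Rightarrow> 'r set"
  where "keel_relations D n =
    (let N = {1..n+1}; X = keel_generators n;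
         \<sigma> = (\<lambda>i j k l. \<Sum>S | S \<in> X \<and> i \<in> S \<and> j \<in> S \<and> k \<notin> S \<and> l \<notin> S. D S)
     in {D S - D (N - S) | S. S \<in> X}
      \<union> {\<sigma> i j k l - \<sigma> i k j l | i j k l. {i, j, k, l} \<subseteq> N \<and> distinct [i, j, k, l]}
      \<union> {\<sigma> i k j l - \<sigma> i l j k | i j k l. {i, j, k, l} \<subseteq> N \<and> distinct [i, j, k, l]}
      \<union> {D S * D T | S T. S \<in> X \<and> T \<in> X \<and>
           S \<inter> T \<noteq> {} \<and> S - T \<noteq> {} \<and> T - S \<noteq> {} \<and> N - (S \<union> T) \<noteq> {}})"

definition dcp_generators :: "nat \<Rightarrow> nat set set"
  where "dcp_generators n = {S. S \<subseteq> {1..n} \<and> 2 \<le> card S \<and> card S \<le> n}"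

definition dcp_relations :: "(nat set \<Rightarrow> 'r::ring_1) \<Rightarrow> nat \<Rightarrow> 'r set"
  where "dcp_relations Y n =
    (let X = dcp_generators n
     in {(\<Sum>S | S \<in> X \<and> i \<in> S \<and> j \<in> S. Y S) | i j. i \<in> {1..n} \<and> j \<in> {1..n} \<and> i \<noteq> j}
      \<union> {Y S * Y T | S T. S \<in> X \<and> T \<in> X \<and> S \<inter> T \<noteq> {} \<and> \<not> S \<subseteq> T \<and> \<not> T \<subseteq> S})"

definition commutators :: "('x \<Rightarrow> 'r::ring_1) \<Rightarrow> 'x set \<Rightarrow> 'r set"
  where "commutators g X = {g x * g y - g y * g x | x y. x \<in> X \<and> y \<in> X}"

definition keel_ideal :: "nat \<Rightarrow> ((nat set \<Rightarrow>\<^sub>0 nat) \<Rightarrow>\<^sub>0 int) set"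
  where "keel_ideal n =
    two_sided_ideal (polynomials (comm_monomials (keel_generators n)))
      (keel_relations comm_gen n)"

definition keel_nc_ideal :: "nat \<Rightarrow> (nat set nc_monomial \<Rightarrow>\<^sub>0 int) set"
  where "keel_nc_ideal n =
    two_sided_ideal (polynomials (nc_monomials (keel_generators n)))
      (keel_relations nc_gen n \<union> commutators nc_gen (keel_generators n))"

definition dcp_ideal :: "nat \<Rightarrow> ((nat set \<Rightarrow>\<^sub>0 nat) \<Rightarrow>\<^sub>0 int) set"
  where "dcp_ideal n =
    two_sided_ideal (polynomials (comm_monomials (dcp_generators n)))
      (dcp_relations comm_gen n)"

definition dcp_nc_ideal :: "nat \<Rightarrow> (nat set nc_monomial \<Rightarrow>\<^sub>0 int) set"
  where "dcp_nc_ideal n =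
    two_sided_ideal (polynomials (nc_monomials (dcp_generators n)))
      (dcp_relations nc_gen n \<union> commutators nc_gen (dcp_generators n))"

end

theory Submission
  imports Defs "HOL-Library.Numeral_Type"
begin

text \<open>
  The argument looks only at powers of one generator. Let \<open>z\<close> be the generator whose monomial
  is least. Then \<open>z\<^sup>d\<close> is the least of all monomials of weight \<open>d\<close>, for words just as for
  commutative monomials. Suppose that some power of \<open>z\<close> lies in the ideal \<open>I\<close>. The leading
  monomial of some element \<open>g\<close> of a Groebner basis divides this power, so it is itself a power
  of \<open>z\<close>. If \<open>g\<close> is homogeneous of weight 1 or 2, its leading monomial is the least one of its
  weight, hence \<open>g\<close> is \<open>z\<close> or \<open>z\<^sup>2\<close>, and \<open>z\<^sup>2\<close> lies in \<open>I\<close>. So there is no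
  linear-and-quadratic Groebner basis once two facts are known: every generator is nilpotent in the
  quotient, and no generator has square zero there (\<open>no_linear_and_quadratic_groebner_basis\<close>).

  Nilpotence holds for dimension reasons geometrically; algebraically it says that the relations
  have only the zero solution in an integral domain. The sets with nonzero value in a solution
  would form a laminar family because crossing products vanish, and a linear relation chosen
  to suit an inclusion-minimal member \<open>S\<close> reduces to the single term at \<open>S\<close>
  (\<open>crossing_free_vanishing\<close>).

  For the squares, choose a partition of the \<open>n+1\<close> marked points into five blocks such that the
  given set \<open>S\<close> is a union of blocks. Restriction to a boundary stratum isomorphic to
  the moduli space of stable five-pointed curves kills the classes of the sets that are not unions of blocks and sends the other
  ones to classes on a surface, where the intersection form shows that squares do not vanish. The
  classes on the surface have a simple description by sign vectors: a subset \<open>U\<close> of the five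
  blocks is sent to its \<open>\<plusminus>1\<close> indicator vector, negated if \<open>card U\<close> is odd. In this form the
  compatibility with all relations of both presentations is elementary (\<open>ex_realization\<close>).
\<close>

section \<open>The ring of the intersection form of five-pointed curves\<close>

text \<open>
  The graded ring \<open>\<int> \<oplus> \<int>\<^sup>5 \<oplus> \<int>\<close>, in which two elements of degree one are multiplied by the
  symmetric bilinear form \<open>form\<close>. On the sign vectors below, \<open>form\<close> is four times the intersection
  pairing of the moduli space of stable five-pointed rational curves.
\<close>

datatype form_ring = Form_Ring int "5 \<Rightarrow> int" int

definition form :: "(5 \<Rightarrow> int) \<Rightarrow> (5 \<Rightarrow> int) \<Rightarrow> int"
  where "form v w = (\<Sum>i\<in>UNIV. v i) * (\<Sum>i\<in>UNIV. w i) - (\<Sum>i\<in>UNIV. v i * w i)"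

lemma form_commute: "form v w = form w v"
  by (simp add: form_def mult.commute)

lemma form_add_left: "form (\<lambda>i. u i + v i) w = form u w + form v w"
  by (simp add: form_def sum.distrib algebra_simps)

lemma form_scale_left: "form (\<lambda>i. c * v i) w = c * form v w"
  by (simp add: form_def mult.assoc sum_distrib_left [symmetric] right_diff_distrib)

lemma form_add_right: "form w (\<lambda>i. u i + v i) = form w u + form w v"
  by (simp add: form_commute [of w] form_add_left)

lemma form_scale_right: "form w (\<lambda>i. c * v i) = c * form w v"
  by (simp add: form_commute [of w] form_scale_left)

lemma form_zero [simp]: "form (\<lambda>i. 0) w = 0" "form w (\<lambda>i. 0) = 0"
  by (simp_all add: form_def)

instantiation form_ring :: comm_ring_1
begin

definition "0 = Form_Ring 0 (\<lambda>i. 0) 0"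
definition "1 = Form_Ring 1 (\<lambda>i. 0) 0"

fun plus_form_ring where
  "Form_Ring a v s + Form_Ring b w t = Form_Ring (a + b) (\<lambda>i. v i + w i) (s + t)"

fun uminus_form_ring where
  "- Form_Ring a v s = Form_Ring (- a) (\<lambda>i. - v i) (- s)"

fun minus_form_ring where
  "Form_Ring a v s - Form_Ring b w t = Form_Ring (a - b) (\<lambda>i. v i - w i) (s - t)"

fun times_form_ring where
  "Form_Ring a v s * Form_Ring b w t =
    Form_Ring (a * b) (\<lambda>i. a * w i + b * v i) (a * t + b * s + form v w)"

instance
proof
  fix x y z :: form_ring
  show "x + y + z = x + (y + z)" by (cases x; cases y; cases z) (simp add: ac_simps)
  show "x + y = y + x" by (cases x; cases y) (simp add: ac_simps)
  show "0 + x = x" by (cases x) (simp add: zero_form_ring_def)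
  show "- x + x = 0" by (cases x) (simp add: zero_form_ring_def)
  show "x - y = x + - y" by (cases x; cases y) simp
  show "x * y * z = x * (y * z)"
    by (cases x; cases y; cases z)
      (simp add: form_add_left form_scale_left form_add_right form_scale_right algebra_simps)
  show "x * y = y * x" by (cases x; cases y) (simp add: form_commute ac_simps)
  show "1 * x = x" by (cases x) (simp add: one_form_ring_def)
  show "(x + y) * z = x * z + y * z"
    by (cases x; cases y; cases z) (simp add: form_add_left algebra_simps)
  show "(0::form_ring) \<noteq> 1" by (simp add: zero_form_ring_def one_form_ring_def)
qed

end

text \<open>
  A subset of the five points and its complement define the same boundary divisor. The sign
  \<open>(- 1) ^ card U\<close> makes the two indicator vectors agree, since exactly one of the two sets
  has an even number of elements. For \<open>card U \<in> {1, 4}\<close> the vector represents the negative of a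
  cotangent line class.
\<close>

definition sign_vector :: "5 set \<Rightarrow> 5 \<Rightarrow> int"
  where "sign_vector U i = (- 1) ^ card U * (if i \<in> U then 1 else - 1)"

lemma card_add_card_Compl: "card U + card (- U) = 5" for U :: "5 set"
  using card_Un_disjoint [of U "- U"] by (simp add: Compl_partition)

lemma sign_vector_Compl: "sign_vector (- U) = sign_vector U"
proof
  fix i
  have "odd (card U + card (- U))"
    by (simp add: card_add_card_Compl)
  then have "(- 1 :: int) ^ card (- U) = - ((- 1) ^ card U)"
    by (cases "even (card U)") simp_all
  then show "sign_vector (- U) i = sign_vector U i"
    by (simp add: sign_vector_def)
qed

lemma sum_indicator_signs:
  fixes U :: "5 set"
  shows "(\<Sum>i\<in>UNIV. if i \<in> U then 1 else - 1 :: int) = 2 * int (card U) - 5"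
proof -
  have "(\<Sum>i\<in>UNIV. if i \<in> U then 1 else - 1 :: int) = int (card U) - int (card (- U))"
    by (simp add: sum.If_cases)
  with card_add_card_Compl [of U] show ?thesis by simp
qed

lemma sum_sign_vector: "(\<Sum>i\<in>UNIV. sign_vector U i) = (- 1) ^ card U * (2 * int (card U) - 5)"
  by (simp add: sign_vector_def sum_distrib_left [symmetric] sum_indicator_signs)

lemma form_sign_vector:
  "form (sign_vector U) (sign_vector W) = (- 1) ^ card U * (- 1) ^ card W *
    ((2 * int (card U) - 5) * (2 * int (card W) - 5) - (5 - 2 * int (card (U - W) + card (W - U))))"
proof -
  have "(\<Sum>i\<in>UNIV. sign_vector U i * sign_vector W i) =
      (- 1) ^ card U * (- 1) ^ card W * (\<Sum>i\<in>UNIV. - (if i \<in> (U - W) \<union> (W - U) then 1 else - 1))"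
    unfolding sum_distrib_left by (rule sum.cong) (auto simp: sign_vector_def)
  also have "(\<Sum>i\<in>UNIV. - (if i \<in> (U - W) \<union> (W - U) then 1 else - 1 :: int)) =
      5 - 2 * int (card ((U - W) \<union> (W - U)))"
    unfolding sum_negf sum_indicator_signs by simp
  also have "card ((U - W) \<union> (W - U)) = card (U - W) + card (W - U)"
    by (rule card_Un_disjoint) auto
  finally show ?thesis
    unfolding form_def sum_sign_vector by (simp add: algebra_simps)
qed

text \<open>
  The square is \<open>s\<^sup>2 - 5\<close> for the integer \<open>s = 2 * card U - 5\<close>, and 5 is not a square.
\<close>

lemma form_sign_vector_self: "form (sign_vector U) (sign_vector U) \<noteq> 0"
proof
  assume "form (sign_vector U) (sign_vector U) = 0"
  then have eq: "(2 * int (card U) - 5) * (2 * int (card U) - 5) = 5"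
    by (simp add: form_sign_vector)
  have "card U \<le> 5"
    using card_add_card_Compl [of U] by simp
  then have "card U = 0 \<or> card U = 1 \<or> card U = 2 \<or> card U = 3 \<or> card U = 4 \<or> card U = 5"
    by linarith
  with eq show False by auto
qed

text \<open>
  The four regions cut out by two crossing sets are nonempty and have five points in total, so
  one of them has two points and the others have one. In each of these four cases the product of
  the coordinate sums equals the scalar product.
\<close>

lemma form_sign_vector_crossing:
  assumes "U \<inter> W \<noteq> {}" "U - W \<noteq> {}" "W - U \<noteq> {}" "U \<union> W \<noteq> UNIV"
  shows "form (sign_vector U) (sign_vector W) = 0"
proof -
  define a b c d where "a = card (U \<inter> W)" and "b = card (U - W)" and "c = card (W - U)"
    and "d = card (- (U \<union> W))"
  have pos: "a \<ge> 1" "b \<ge> 1" "c \<ge> 1" "d \<ge> 1"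
    using assms by (auto simp: a_def b_def c_def d_def Suc_le_eq card_gt_0_iff)
  have U: "card U = a + b"
    unfolding a_def b_def by (subst card_Un_disjoint [symmetric]) (auto intro: arg_cong [where f = card])
  have W: "card W = a + c"
    unfolding a_def c_def by (subst card_Un_disjoint [symmetric]) (auto intro: arg_cong [where f = card])
  have "card (- U) = c + d"
    unfolding c_def d_def by (subst card_Un_disjoint [symmetric]) (auto intro: arg_cong [where f = card])
  then have "a + b + c + d = 5"
    using U card_add_card_Compl [of U] by simp
  with pos have "a \<le> 2" "b \<le> 2" "c \<le> 2" "a + b + c + d = 5" by auto
  with pos have "(a, b, c) \<in> {(2,1,1), (1,2,1), (1,1,2), (1,1,1)}" by auto
  then show ?thesis
    unfolding form_sign_vector U W b_def [symmetric] c_def [symmetric] by auto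
qed

text \<open>
  Among the five indices there is one, \<open>q\<close>, that differs from \<open>a\<close>, \<open>b\<close>, \<open>e\<close> and \<open>p\<close>. Adding or
  removing \<open>q\<close> preserves the range of summation and reverses the sign of the \<open>p\<close>-th coordinate,
  so the terms cancel in pairs.
\<close>

lemma sum_sign_vector_eq_0: "(\<Sum>U | a \<in> U \<and> b \<in> U \<and> e \<notin> U. sign_vector U p) = 0"
proof -
  have "card {a, b, e, p} \<le> 4"
    using card_length [of "[a, b, e, p]"] by simp
  then have "card {a, b, e, p} < card (UNIV :: 5 set)"
    by simp
  then have "{a, b, e, p} \<noteq> UNIV"
    by (rule contrapos_pn) simp
  then obtain q where q: "q \<notin> {a, b, e, p}" by blast
  define toggle where "toggle U = (if q \<in> U then U - {q} else insert q U)" for U :: "5 set"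
  have "sign_vector (toggle U) p = - sign_vector U p" for U
  proof (cases "q \<in> U")
    case True
    then obtain W where "U = insert q W" "q \<notin> W"
      by (metis mk_disjoint_insert)
    with q show ?thesis by (auto simp: sign_vector_def toggle_def)
  next
    case False
    with q show ?thesis by (auto simp: sign_vector_def toggle_def)
  qed
  then have "(\<Sum>U | a \<in> U \<and> b \<in> U \<and> e \<notin> U. sign_vector U p) =
      (\<Sum>U | a \<in> U \<and> b \<in> U \<and> e \<notin> U. - sign_vector U p)"
    using q by (intro sum.reindex_bij_witness [of _ toggle toggle]) (auto simp: toggle_def)
  then show ?thesis by (simp add: sum_negf)
qed

section \<open>Evaluation of polynomials\<close>

definition evaluation :: "('m \<Rightarrow> 'a::comm_ring_1) \<Rightarrow> ('m \<Rightarrow>\<^sub>0 int) \<Rightarrow> 'a"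
  where "evaluation \<mu> p = (\<Sum>m\<in>Poly_Mapping.keys p. of_int (Poly_Mapping.lookup p m) * \<mu> m)"

lemma evaluation_superset:
  assumes "finite K" "Poly_Mapping.keys p \<subseteq> K"
  shows "evaluation \<mu> p = (\<Sum>m\<in>K. of_int (Poly_Mapping.lookup p m) * \<mu> m)"
  unfolding evaluation_def using assms
  by (intro sum.mono_neutral_left) (auto simp: in_keys_iff)

lemma evaluation_0 [simp]: "evaluation \<mu> 0 = 0"
  by (simp add: evaluation_def)

lemma evaluation_add: "evaluation \<mu> (p + q) = evaluation \<mu> p + evaluation \<mu> q"
proof -
  let ?K = "Poly_Mapping.keys p \<union> Poly_Mapping.keys q"
  have "evaluation \<mu> f = (\<Sum>m\<in>?K. of_int (Poly_Mapping.lookup f m) * \<mu> m)"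
    if "f \<in> {p, q, p + q}" for f
    using that keys_add [of p q] by (intro evaluation_superset) auto
  then show ?thesis
    by (simp add: lookup_add distrib_right sum.distrib)
qed

lemma evaluation_diff: "evaluation \<mu> (p - q) = evaluation \<mu> p - evaluation \<mu> q"
  using evaluation_add [of \<mu> "p - q" q] by (simp add: algebra_simps)

lemma evaluation_sum: "evaluation \<mu> (\<Sum>x\<in>B. f x) = (\<Sum>x\<in>B. evaluation \<mu> (f x))"
  by (induction B rule: infinite_finite_induct) (simp_all add: evaluation_add)

lemma evaluation_frag_of [simp]: "evaluation \<mu> (frag_of m) = \<mu> m"
  by (simp add: evaluation_def)

lemma evaluation_mult:
  fixes \<mu> :: "'m::monoid_add \<Rightarrow> 'a::comm_ring_1"
  assumes \<mu>: "\<And>u v. \<mu> (u + v) = \<mu> u * \<mu> v"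
  shows "evaluation \<mu> (p * q) = evaluation \<mu> p * evaluation \<mu> q"
proof (induction p rule: frag_induction [OF subset_UNIV])
  case (2 u)
  show ?case
    by (induction q rule: frag_induction [OF subset_UNIV])
      (simp_all add: mult_single \<mu> right_diff_distrib evaluation_diff)
qed (simp_all add: left_diff_distrib evaluation_diff)

lemma evaluation_ideal:
  fixes \<mu> :: "'m::monoid_add \<Rightarrow> 'a::comm_ring_1"
  assumes \<mu>: "\<And>u v. \<mu> (u + v) = \<mu> u * \<mu> v"
    and R: "\<And>r. r \<in> R \<Longrightarrow> evaluation \<mu> r = 0"
    and p: "p \<in> two_sided_ideal A R"
  shows "evaluation \<mu> p = 0"
  using p by induction (simp_all add: evaluation_add evaluation_mult [OF \<mu>] R)

section \<open>Radicals of ideals with commutative quotient\<close>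

text \<open>
  Two-sided ideals with commutative quotient. Commutative and noncommutative presentations are
  treated alike by calculating with elements of the subring \<open>A\<close> modulo \<open>J\<close>.
\<close>

locale commuting_ideal =
  fixes A J :: "'r::ring_1 set"
  assumes one_closed: "1 \<in> A"
    and diff_closed: "\<And>a b. a \<in> A \<Longrightarrow> b \<in> A \<Longrightarrow> a - b \<in> A"
    and mult_closed: "\<And>a b. a \<in> A \<Longrightarrow> b \<in> A \<Longrightarrow> a * b \<in> A"
    and ideal_subset: "J \<subseteq> A"
    and ideal_zero: "0 \<in> J"
    and ideal_add: "\<And>p q. p \<in> J \<Longrightarrow> q \<in> J \<Longrightarrow> p + q \<in> J"
    and ideal_left: "\<And>a p. a \<in> A \<Longrightarrow> p \<in> J \<Longrightarrow> a * p \<in> J"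
    and ideal_right: "\<And>a p. a \<in> A \<Longrightarrow> p \<in> J \<Longrightarrow> p * a \<in> J"
    and ideal_commutator: "\<And>a b. a \<in> A \<Longrightarrow> b \<in> A \<Longrightarrow> a * b - b * a \<in> J"
begin

lemma zero_closed: "0 \<in> A"
  using diff_closed [OF one_closed one_closed] by simp

lemma add_closed: "a \<in> A \<Longrightarrow> b \<in> A \<Longrightarrow> a + b \<in> A"
  using diff_closed [of a "0 - b"] diff_closed [OF zero_closed] by simp

lemma power_closed: "a \<in> A \<Longrightarrow> a ^ k \<in> A"
  by (induction k) (simp_all add: one_closed mult_closed)

lemma ideal_uminus: "p \<in> J \<Longrightarrow> - p \<in> J"
  using ideal_left [of "0 - 1" p] diff_closed [OF zero_closed one_closed] by simp

lemma ideal_diff: "p \<in> J \<Longrightarrow> q \<in> J \<Longrightarrow> p - q \<in> J"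
  using ideal_add [of p "- q"] ideal_uminus by simp

lemma ideal_sum: "(\<And>x. x \<in> B \<Longrightarrow> f x \<in> J) \<Longrightarrow> (\<Sum>x\<in>B. f x) \<in> J"
  by (induction B rule: infinite_finite_induct) (simp_all add: ideal_zero ideal_add)

lemma ideal_add_cancel: "q \<in> J \<Longrightarrow> p + q \<in> J \<Longrightarrow> p \<in> J"
  using ideal_diff [of "p + q" q] by simp

lemma ideal_diff_cancel: "q \<in> J \<Longrightarrow> p - q \<in> J \<Longrightarrow> p \<in> J"
  using ideal_add [of "p - q" q] by simp

lemma ideal_swap:
  assumes "a \<in> A" "b \<in> A" "c \<in> A" "d \<in> A" "a * b * c * d \<in> J"
  shows "a * c * b * d \<in> J"
proof -
  have "a * (b * c - c * b) * d \<in> J"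
    using assms by (intro ideal_left ideal_right ideal_commutator)
  then have "a * b * c * d - a * (b * c - c * b) * d \<in> J"
    using assms by (intro ideal_diff)
  then show ?thesis
    by (simp add: algebra_simps)
qed

lemma ideal_swap_right: "a \<in> A \<Longrightarrow> b \<in> A \<Longrightarrow> c \<in> A \<Longrightarrow> a * b * c \<in> J \<Longrightarrow> a * c * b \<in> J"
  using ideal_swap [of a b c 1] by (simp add: one_closed)

definition radical :: "'r set"
  where "radical = {p \<in> A. \<exists>k. p ^ k \<in> J}"

text \<open>
  Binomial expansion modulo \<open>J\<close>, organised as an induction on the exponent of \<open>p + q\<close>: splitting
  off one factor raises the exponent of \<open>p\<close> or of \<open>q\<close> by one, so at the end one of these two
  exponents is large.
\<close>

lemma radical_add:
  assumes "p \<in> radical" "q \<in> radical"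
  shows "p + q \<in> radical"
proof -
  obtain k l where p: "p \<in> A" "p ^ k \<in> J" and q: "q \<in> A" "q ^ l \<in> J"
    using assms by (auto simp: radical_def)
  have "p ^ a * q ^ b * (p + q) ^ m \<in> J" if "a + b + m \<ge> k + l" for a b m
    using that
  proof (induction m arbitrary: a b)
    case 0
    consider "a \<ge> k" | "b \<ge> l" using 0 by fastforce
    then show ?case
    proof cases
      case 1
      then have "p ^ a = p ^ k * p ^ (a - k)"
        by (simp flip: power_add)
      with p q show ?thesis
        by (auto intro!: ideal_right power_closed)
    next
      case 2
      then have "q ^ b = q ^ k' * q ^ l" if "k' = b - l" for k'
        using that by (simp flip: power_add)
      with p q show ?thesis
        by (auto intro!: ideal_left power_closed)
    qed
  next
    case (Suc m)
    have "p ^ a * p * q ^ b * (p + q) ^ m \<in> J"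
      using Suc.IH [of "Suc a" b] Suc.prems by (simp add: power_Suc2 del: power_Suc)
    then have "p ^ a * q ^ b * p * (p + q) ^ m \<in> J"
      using p q by (intro ideal_swap [of _ p]) (auto intro!: power_closed add_closed)
    moreover have "p ^ a * q ^ b * q * (p + q) ^ m \<in> J"
      using Suc.IH [of a "Suc b"] Suc.prems by (simp add: power_Suc2 mult.assoc del: power_Suc)
    ultimately have "p ^ a * q ^ b * p * (p + q) ^ m + p ^ a * q ^ b * q * (p + q) ^ m \<in> J"
      by (rule ideal_add)
    then show ?case
      by (simp add: algebra_simps)
  qed
  from this [of 0 0 "k + l"] p q show ?thesis
    by (auto simp: radical_def intro!: add_closed)
qed

text \<open>
  The outer factors \<open>c\<close> and \<open>d\<close> give the induction room: each step moves one factor \<open>a * b\<close>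
  into \<open>c\<close>.
\<close>

lemma mult_power_in_ideal:
  assumes "a \<in> A" "b \<in> A" "c \<in> A" "d \<in> A" "c * a ^ k * b ^ k * d \<in> J"
  shows "c * (a * b) ^ k * d \<in> J"
  using assms
proof (induction k arbitrary: c d)
  case (Suc k)
  have "c * a * (a ^ k * b ^ k) * b * d \<in> J"
    using Suc.prems by (simp add: power_Suc2 [of b] mult.assoc del: power_Suc) (simp add: mult.assoc)
  then have "(c * a) * (a ^ k * b ^ k) * b * d \<in> J" by simp
  then have "(c * a) * b * (a ^ k * b ^ k) * d \<in> J"
    using Suc.prems by (intro ideal_swap [of "c * a" "a ^ k * b ^ k"]) (auto intro!: mult_closed power_closed)
  then have "(c * (a * b)) * a ^ k * b ^ k * d \<in> J"
    by (simp add: mult.assoc)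
  then have "(c * (a * b)) * (a * b) ^ k * d \<in> J"
    using Suc.prems by (intro Suc.IH) (auto intro!: mult_closed)
  then show ?case
    by (simp add: mult.assoc)
qed simp

lemma radical_mult:
  assumes "a \<in> A" "p \<in> radical"
  shows "a * p \<in> radical" and "p * a \<in> radical"
proof -
  obtain k where p: "p \<in> A" "p ^ k \<in> J"
    using assms by (auto simp: radical_def)
  have "a ^ k * p ^ k \<in> J" "p ^ k * a ^ k \<in> J"
    using assms p by (simp_all add: ideal_left ideal_right power_closed)
  then have "(a * p) ^ k \<in> J" "(p * a) ^ k \<in> J"
    using mult_power_in_ideal [of a p 1 1 k] mult_power_in_ideal [of p a 1 1 k] assms p
    by (simp_all add: one_closed)
  then show "a * p \<in> radical" "p * a \<in> radical"
    using assms p by (auto simp: radical_def mult_closed)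
qed

lemma ideal_subset_radical: "J \<subseteq> radical"
  using ideal_subset by (auto simp: radical_def intro!: exI [of _ 1])

lemma commuting_ideal_radical: "commuting_ideal A radical"
proof -
  have "radical \<subseteq> A"
    by (auto simp: radical_def)
  then show ?thesis
    using ideal_zero ideal_commutator ideal_subset_radical
    by unfold_locales (auto simp: one_closed diff_closed mult_closed radical_add radical_mult)
qed

lemma radical_semiprime:
  assumes "p \<in> A" "p * p \<in> radical"
  shows "p \<in> radical"
proof -
  obtain k where "(p * p) ^ k \<in> J"
    using assms by (auto simp: radical_def)
  then have "p ^ (2 * k) \<in> J"
    by (simp add: power_mult power2_eq_square)
  with assms show ?thesis by (auto simp: radical_def)
qed

end

section \<open>Nilpotence of the generators\<close>

text \<open>
  In an integral domain the sets \<open>T\<close> with \<open>y T \<noteq> 0\<close> would be pairwise nested or disjoint. Given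
  an inclusion-minimal one, \<open>S\<close>, choose \<open>i \<noteq> j\<close> in \<open>S\<close> and a point \<open>k\<close> outside \<open>S\<close> that lies in
  every larger one. Then \<open>y S\<close> is the only nonzero term of the linear relation for \<open>i, j, k\<close>.

  The passage to an integral domain is replaced by multiplication with an element \<open>a\<close> such that
  as many products \<open>a * y T\<close> as possible, but not all of them, lie in the semiprime ideal \<open>J\<close>.
  By maximality \<open>y S * y T \<notin> J\<close> for all \<open>S\<close> and \<open>T\<close> with \<open>a * y S \<notin> J\<close> and \<open>a * y T \<notin> J\<close>: these
  sets take the place of the sets with nonzero value.
\<close>

lemma (in commuting_ideal) crossing_free_vanishing:
  fixes V :: "'v set" and y :: "'v set \<Rightarrow> 'r"
  defines "X \<equiv> {T. T \<subseteq> V \<and> 2 \<le> card T \<and> T \<noteq> V}"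
  assumes semiprime: "\<And>p. p \<in> A \<Longrightarrow> p * p \<in> J \<Longrightarrow> p \<in> J"
    and V: "finite V"
    and y: "\<And>T. T \<in> X \<Longrightarrow> y T \<in> A"
    and crossing: "\<And>S T. S \<in> X \<Longrightarrow> T \<in> X \<Longrightarrow> S \<inter> T \<noteq> {} \<Longrightarrow> \<not> S \<subseteq> T \<Longrightarrow> \<not> T \<subseteq> S
      \<Longrightarrow> y S * y T \<in> J"
    and linear: "\<And>i j k. {i, j, k} \<subseteq> V \<Longrightarrow> distinct [i, j, k] \<Longrightarrow>
      (\<Sum>T | T \<in> X \<and> i \<in> T \<and> j \<in> T \<and> k \<notin> T. y T)
      - (\<Sum>T | T \<in> X \<and> i \<in> T \<and> k \<in> T \<and> j \<notin> T. y T) \<in> J"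
    and S: "S \<in> X"
  shows "y S \<in> J"
proof (rule ccontr)
  assume "y S \<notin> J"
  have X: "finite X"
    using V by (auto simp: X_def intro: finite_subset [of _ "Pow V"])
  define bad where "bad a \<longleftrightarrow> a \<in> A \<and> (\<exists>T\<in>X. a * y T \<notin> J)" for a
  define ann where "ann a = {T \<in> X. a * y T \<in> J}" for a
  have "bad 1"
    using \<open>y S \<notin> J\<close> S by (auto simp: bad_def one_closed)
  moreover have "\<forall>a. bad a \<longrightarrow> card (ann a) < Suc (card X)"
    using X by (auto simp: ann_def less_Suc_eq_le intro!: card_mono)
  ultimately obtain a where a: "bad a" and max: "\<And>b. bad b \<Longrightarrow> card (ann b) \<le> card (ann a)"
    using ex_has_greatest_nat [of bad 1 "\<lambda>a. card (ann a)" "Suc (card X)"] by blast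
  define C where "C = {T \<in> X. a * y T \<notin> J}"
  have aA: "a \<in> A" and C: "C \<noteq> {}" "C \<subseteq> X" "finite C"
    using a X by (auto simp: bad_def C_def)
  have not_cross: "y S * y T \<notin> J" if "S \<in> C" "T \<in> C" for S T
  proof
    assume "y S * y T \<in> J"
    have yS: "y S \<in> A" using that C y by auto
    \<comment> \<open>Multiplication by \<open>y S\<close> enlarges the annihilator, so it must yield everything, in
      particular \<open>a * y S * y S\<close>; the semiprime property then gives \<open>a * y S\<close>.\<close>
    have "ann a \<subseteq> ann (a * y S)"
      using aA yS y ideal_swap_right [OF aA _ yS ideal_right [OF yS]] by (auto simp: ann_def)
    moreover have "T \<in> ann (a * y S) - ann a"
      using that aA \<open>y S * y T \<in> J\<close> by (auto simp: ann_def C_def mult.assoc intro: ideal_left)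
    ultimately have "ann a \<subset> ann (a * y S)" by blast
    then have "card (ann a) < card (ann (a * y S))"
      using X by (intro psubset_card_mono) (auto simp: ann_def)
    with max have "\<not> bad (a * y S)" by (meson leD)
    then have "a * y S * y S \<in> J"
      using that C aA yS by (auto simp: bad_def mult_closed)
    then have "a * (a * y S * y S) \<in> J"
      by (rule ideal_left [OF aA])
    then have "a * y S * (a * y S) \<in> J"
      using ideal_swap [of a a "y S" "y S"] aA yS by (simp add: mult.assoc)
    then have "a * y S \<in> J"
      by (rule semiprime [rotated]) (use aA yS in \<open>simp_all add: mult_closed\<close>)
    with that show False by (simp add: C_def)
  qed
  then have nested: "S \<subseteq> T \<or> T \<subseteq> S" if "S \<in> C" "T \<in> C" "S \<inter> T \<noteq> {}" for S T
    using that C crossing by blast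
  obtain S where S: "S \<in> C" and min: "\<And>T. T \<in> C \<Longrightarrow> card S \<le> card T"
    using ex_is_arg_min_if_finite [OF C(3,1), of card] by (auto simp: is_arg_min_linorder)
  have fin: "finite T" if "T \<in> C" for T
    using that C V by (auto simp: X_def intro: finite_subset)
  have SV: "S \<subset> V" "2 \<le> card S"
    using S C by (auto simp: X_def)
  obtain i j where ij: "i \<in> S" "j \<in> S" "i \<noteq> j"
    using SV(2) by (metis card_2_iff' obtain_subset_with_card_n subsetD)
  have eq_S: "T = S" if "T \<in> C" "T \<subseteq> S" for T
    using that min fin S by (metis card_seteq)
  \<comment> \<open>The sets in \<open>C\<close> above \<open>S\<close> form a chain, so any point of the smallest one outside \<open>S\<close> will
    do; if there is none, any point outside \<open>S\<close>.\<close>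
  obtain k where k: "k \<in> V - S" "\<And>T. T \<in> C \<Longrightarrow> S \<subset> T \<Longrightarrow> k \<in> T"
  proof (cases "\<exists>T\<in>C. S \<subset> T")
    case True
    then have "{T \<in> C. S \<subset> T} \<noteq> {}" "finite {T \<in> C. S \<subset> T}"
      using C(3) by auto
    then obtain T where T: "T \<in> C" "S \<subset> T" and Tmin: "\<And>T'. T' \<in> C \<Longrightarrow> S \<subset> T' \<Longrightarrow> card T \<le> card T'"
      using ex_is_arg_min_if_finite [of "{T \<in> C. S \<subset> T}" card] by (auto simp: is_arg_min_linorder)
    then obtain k where "k \<in> T" "k \<notin> S" by blast
    moreover have "T \<subseteq> T'" if "T' \<in> C" "S \<subset> T'" for T'
    proof -
      have "T \<subseteq> T' \<or> T' \<subseteq> T"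
        using nested [of T T'] that T ij by blast
      then show ?thesis
        using Tmin [OF that] fin [OF T(1)] by (metis card_seteq order_refl)
    qed
    moreover have "T \<subseteq> V"
      using T C by (auto simp: X_def)
    ultimately show ?thesis
      by (intro that [of k]) blast+
  next
    case False
    with SV that show ?thesis by blast
  qed
  let ?P = "{T \<in> X. i \<in> T \<and> j \<in> T \<and> k \<notin> T}" and ?Q = "{T \<in> X. i \<in> T \<and> k \<in> T \<and> j \<notin> T}"
  have P: "T = S" if "T \<in> ?P" "T \<in> C" for T
  proof -
    have "S \<subseteq> T \<or> T \<subseteq> S"
      using nested [OF S that(2)] that ij by blast
    with eq_S k(2) that show ?thesis by blast
  qed
  have Q: "T \<notin> C" if "T \<in> ?Q" for T
    using nested [OF S, of T] that ij k by blast
  have "a * (sum y ?P - sum y ?Q) \<in> J"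
    using linear [of i j k] ij SV k(1) aA by (intro ideal_left) auto
  moreover have "sum y ?P = y S + sum y (?P - {S})"
    using X ij k S C by (intro sum.remove) auto
  ultimately have "(a * y S + (\<Sum>T\<in>?P - {S}. a * y T)) - (\<Sum>T\<in>?Q. a * y T) \<in> J"
    by (simp add: algebra_simps sum_distrib_left)
  moreover have "(\<Sum>T\<in>?P - {S}. a * y T) \<in> J" "(\<Sum>T\<in>?Q. a * y T) \<in> J"
    using P Q by (auto intro!: ideal_sum simp: C_def)
  ultimately have "a * y S \<in> J"
    using ideal_diff_cancel ideal_add_cancel by blast
  with S show False by (simp add: C_def)
qed

lemma Compl_mem_keel_generators:
  assumes "S \<in> keel_generators n"
  shows "{1..n+1} - S \<in> keel_generators n"
proof -
  have "finite S"
    using assms by (auto simp: keel_generators_def intro: finite_subset)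
  then have "card ({1..n+1} - S) = n + 1 - card S"
    using assms by (subst card_Diff_subset) (auto simp: keel_generators_def)
  then show ?thesis
    using assms by (auto simp: keel_generators_def)
qed

lemma Compl_in_keel_relations:
  assumes "S \<in> keel_generators n"
  shows "D S - D ({1..n+1} - S) \<in> keel_relations D n"
  unfolding keel_relations_def Let_def
  by (rule UnI1, rule UnI1, rule UnI1, rule CollectI, rule exI [of _ S]) (use assms in simp)

lemma exchange_in_keel_relations:
  assumes "{i, j, k, l} \<subseteq> {1..n+1}" "distinct [i, j, k, l]"
  shows "(\<Sum>S | S \<in> keel_generators n \<and> i \<in> S \<and> j \<in> S \<and> k \<notin> S \<and> l \<notin> S. D S)
      - (\<Sum>S | S \<in> keel_generators n \<and> i \<in> S \<and> k \<in> S \<and> j \<notin> S \<and> l \<notin> S. D S)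
      \<in> keel_relations D n"
  unfolding keel_relations_def Let_def
  by (rule UnI1, rule UnI1, rule UnI2, rule CollectI,
      rule exI [of _ i], rule exI [of _ j], rule exI [of _ k], rule exI [of _ l])
    (use assms in simp)

text \<open>
  Up to complement, a generator is given by a set avoiding the point \<open>n+1\<close>. For two such sets the
  fourth region of the crossing condition contains \<open>n+1\<close>, and the linear relation for
  \<open>i, j, k, n+1\<close> involves only such sets.
\<close>

lemma (in commuting_ideal) keel_vanishing:
  fixes D :: "nat set \<Rightarrow> 'r"
  assumes semiprime: "\<And>p. p \<in> A \<Longrightarrow> p * p \<in> J \<Longrightarrow> p \<in> J"
    and D: "\<And>S. S \<in> keel_generators n \<Longrightarrow> D S \<in> A"
    and rel: "keel_relations D n \<subseteq> J"
    and S: "S \<in> keel_generators n"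
  shows "D S \<in> J"
proof -
  let ?N = "{1..n+1}" and ?V = "{1..n}"
  have card_lt: "card T < n" if "T \<subset> ?V" for T
    using psubset_card_mono [OF _ that] by simp
  have card_eq: "card T = n" if "card T \<ge> n" "T \<subseteq> ?V" for T
    using card_mono [OF _ that(2)] that by simp
  have X: "{T. T \<subseteq> ?V \<and> 2 \<le> card T \<and> T \<noteq> ?V} = {T \<in> keel_generators n. n + 1 \<notin> T}"
  proof (intro set_eqI iffI)
    fix T assume T: "T \<in> {T. T \<subseteq> ?V \<and> 2 \<le> card T \<and> T \<noteq> ?V}"
    then have "card T < n" using card_lt by blast
    with T show "T \<in> {T \<in> keel_generators n. n + 1 \<notin> T}"
      by (fastforce simp: keel_generators_def)
  next
    fix T assume T: "T \<in> {T \<in> keel_generators n. n + 1 \<notin> T}"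
    then have "T \<subseteq> ?V"
      by (auto simp: keel_generators_def subset_iff) (metis le_SucE)
    with T show "T \<in> {T. T \<subseteq> ?V \<and> 2 \<le> card T \<and> T \<noteq> ?V}"
      by (auto simp: keel_generators_def)
  qed
  have vanish: "D T \<in> J" if T: "T \<in> keel_generators n" "n + 1 \<notin> T" for T
  proof (rule crossing_free_vanishing [where V = ?V and y = D, OF semiprime, unfolded X])
    fix S T
    assume "S \<in> {T \<in> keel_generators n. n + 1 \<notin> T}" "T \<in> {T \<in> keel_generators n. n + 1 \<notin> T}"
      "S \<inter> T \<noteq> {}" "\<not> S \<subseteq> T" "\<not> T \<subseteq> S"
    then have "S \<in> keel_generators n" "T \<in> keel_generators n" "S \<inter> T \<noteq> {}" "S - T \<noteq> {}"
        "T - S \<noteq> {}" "n + 1 \<in> ?N - (S \<union> T)"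
      by auto
    then have "D S * D T \<in> keel_relations D n"
      unfolding keel_relations_def Let_def by blast
    then show "D S * D T \<in> J" using rel by blast
  next
    fix i j k assume ijk: "{i, j, k} \<subseteq> ?V" "distinct [i, j, k]"
    have "{i, j, k, n + 1} \<subseteq> ?N" "distinct [i, j, k, n + 1]"
      using ijk by auto
    note subsetD [OF rel exchange_in_keel_relations [OF this]]
    then show "(\<Sum>T | T \<in> {T \<in> keel_generators n. n + 1 \<notin> T} \<and> i \<in> T \<and> j \<in> T \<and> k \<notin> T. D T)
      - (\<Sum>T | T \<in> {T \<in> keel_generators n. n + 1 \<notin> T} \<and> i \<in> T \<and> k \<in> T \<and> j \<notin> T. D T) \<in> J"
      by (simp add: conj_ac)
  qed (use D T in auto)
  show ?thesis
  proof (cases "n + 1 \<in> S")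
    case True
    then have "D (?N - S) \<in> J"
      using Compl_mem_keel_generators [OF S] vanish by blast
    moreover have "D S - D (?N - S) \<in> J"
      using rel Compl_in_keel_relations [OF S] by blast
    ultimately show ?thesis
      by (rule ideal_diff_cancel)
  qed (use S vanish in auto)
qed

text \<open>
  The difference of the linear relations for \<open>i, j\<close> and for \<open>i, k\<close> contains only sets that separate
  \<open>j\<close> from \<open>k\<close>, so it has the shape needed for the proper subsets of \<open>{1..n}\<close>. Any linear relation
  then disposes of the generator of the whole set.
\<close>

lemma (in commuting_ideal) dcp_vanishing:
  fixes Y :: "nat set \<Rightarrow> 'r"
  assumes semiprime: "\<And>p. p \<in> A \<Longrightarrow> p * p \<in> J \<Longrightarrow> p \<in> J"
    and Y: "\<And>S. S \<in> dcp_generators n \<Longrightarrow> Y S \<in> A"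
    and rel: "dcp_relations Y n \<subseteq> J"
    and S: "S \<in> dcp_generators n"
  shows "Y S \<in> J"
proof -
  let ?V = "{1..n}"
  let ?X = "{T. T \<subseteq> ?V \<and> 2 \<le> card T \<and> T \<noteq> ?V}"
  have gens: "dcp_generators n = {T. T \<subseteq> ?V \<and> 2 \<le> card T}"
    by (auto simp: dcp_generators_def dest: card_mono [rotated])
  have fin: "finite (dcp_generators n)"
    unfolding gens by (rule finite_subset [of _ "Pow ?V"]) auto
  have pair: "(\<Sum>S | S \<in> dcp_generators n \<and> i \<in> S \<and> j \<in> S. Y S) \<in> J"
    if "i \<in> ?V" "j \<in> ?V" "i \<noteq> j" for i j
    using rel that unfolding dcp_relations_def Let_def by blast
  have vanish: "Y T \<in> J" if T: "T \<in> ?X" for T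
  proof (rule crossing_free_vanishing [where V = ?V and y = Y, OF semiprime])
    fix S T
    assume "S \<in> ?X" "T \<in> ?X" "S \<inter> T \<noteq> {}" "\<not> S \<subseteq> T" "\<not> T \<subseteq> S"
    then have "Y S * Y T \<in> dcp_relations Y n"
      unfolding dcp_relations_def Let_def gens by blast
    then show "Y S * Y T \<in> J" using rel by blast
  next
    fix i j k assume ijk: "{i, j, k} \<subseteq> ?V" "distinct [i, j, k]"
    have split: "(\<Sum>S | S \<in> dcp_generators n \<and> a \<in> S \<and> b \<in> S. Y S) =
        (\<Sum>T | T \<in> ?X \<and> a \<in> T \<and> b \<in> T \<and> c \<notin> T. Y T)
        + (\<Sum>T | T \<in> dcp_generators n \<and> a \<in> T \<and> b \<in> T \<and> c \<in> T. Y T)"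
      if "c \<in> ?V" for a b c
    proof -
      have *: "{S. S \<in> dcp_generators n \<and> a \<in> S \<and> b \<in> S} =
          {T. T \<in> ?X \<and> a \<in> T \<and> b \<in> T \<and> c \<notin> T}
          \<union> {T. T \<in> dcp_generators n \<and> a \<in> T \<and> b \<in> T \<and> c \<in> T}"
        using that by (auto simp: gens)
      have fin': "finite {T. T \<in> ?X \<and> a \<in> T \<and> b \<in> T \<and> c \<notin> T}"
        by (rule finite_subset [OF _ fin]) (auto simp: gens)
      show ?thesis
        unfolding * using fin fin' by (intro sum.union_disjoint) auto
    qed
    have "(\<Sum>S | S \<in> dcp_generators n \<and> i \<in> S \<and> j \<in> S. Y S)
        - (\<Sum>S | S \<in> dcp_generators n \<and> i \<in> S \<and> k \<in> S. Y S) \<in> J"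
      using ijk by (intro ideal_diff pair) auto
    also have "{T. T \<in> dcp_generators n \<and> i \<in> T \<and> k \<in> T \<and> j \<in> T}
        = {T. T \<in> dcp_generators n \<and> i \<in> T \<and> j \<in> T \<and> k \<in> T}"
      by auto
    then have "(\<Sum>S | S \<in> dcp_generators n \<and> i \<in> S \<and> j \<in> S. Y S)
        - (\<Sum>S | S \<in> dcp_generators n \<and> i \<in> S \<and> k \<in> S. Y S)
      = (\<Sum>T | T \<in> ?X \<and> i \<in> T \<and> j \<in> T \<and> k \<notin> T. Y T)
        - (\<Sum>T | T \<in> ?X \<and> i \<in> T \<and> k \<in> T \<and> j \<notin> T. Y T)"
      using ijk by (simp only: split [of k i j] split [of j i k] insert_subset simp_thms) simp
    finally show "(\<Sum>T | T \<in> ?X \<and> i \<in> T \<and> j \<in> T \<and> k \<notin> T. Y T)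
        - (\<Sum>T | T \<in> ?X \<and> i \<in> T \<and> k \<in> T \<and> j \<notin> T. Y T) \<in> J" .
  qed (use Y T in \<open>auto simp: gens\<close>)
  show ?thesis
  proof (cases "S = ?V")
    case True
    with S have n: "2 \<le> n" by (simp add: gens)
    let ?P = "{T. T \<in> dcp_generators n \<and> 1 \<in> T \<and> 2 \<in> T}"
    have "sum Y ?P = Y S + sum Y (?P - {S})"
      using fin S True n by (intro sum.remove) auto
    moreover have "sum Y (?P - {S}) \<in> J"
      using True by (intro ideal_sum vanish) (auto simp: gens)
    moreover have "sum Y ?P \<in> J"
      using n by (intro pair) auto
    ultimately show ?thesis
      using ideal_add_cancel [of "sum Y (?P - {S})" "Y S"] by simp
  next
    case False
    with S show ?thesis
      by (intro vanish) (simp add: gens)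
  qed
qed

section \<open>Realizing the relations with nonzero squares\<close>

text \<open>
  Both sets of linear relations follow from the vanishing of the sums over all \<open>T\<close> with \<open>i, j \<in> T\<close>
  and \<open>e \<notin> T\<close>. For \<open>e = n+1\<close> these are the De Concini--Procesi relations. The sum occurring in
  Keel's relations, with \<open>i, j \<in> T\<close> and \<open>k, l \<notin> T\<close>, is therefore the negative of the sum with
  \<open>i, j, k \<in> T\<close> and \<open>l \<notin> T\<close>; this is symmetric in \<open>i, j, k\<close>, and the original sum is symmetric
  in \<open>k, l\<close>.
\<close>

lemma relations_vanish:
  fixes D :: "nat set \<Rightarrow> 'r::comm_ring_1"
  assumes linear: "\<And>i j e. {i, j, e} \<subseteq> {1..n+1} \<Longrightarrow>
      (\<Sum>T | T \<subseteq> {1..n+1} \<and> i \<in> T \<and> j \<in> T \<and> e \<notin> T. D T) = 0"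
    and Compl: "\<And>T. T \<subseteq> {1..n+1} \<Longrightarrow> D ({1..n+1} - T) = D T"
    and crossing: "\<And>S T. S \<subseteq> {1..n+1} \<Longrightarrow> T \<subseteq> {1..n+1} \<Longrightarrow> S \<inter> T \<noteq> {} \<Longrightarrow> S - T \<noteq> {}
      \<Longrightarrow> T - S \<noteq> {} \<Longrightarrow> {1..n+1} - (S \<union> T) \<noteq> {} \<Longrightarrow> D S * D T = 0"
  shows keel_relations_vanish: "r \<in> keel_relations D n \<Longrightarrow> r = 0"
    and dcp_relations_vanish: "r \<in> dcp_relations D n \<Longrightarrow> r = 0"
proof -
  let ?N = "{1..n+1}"
  define s where "s i j k l = (\<Sum>S | S \<in> keel_generators n \<and> i \<in> S \<and> j \<in> S \<and> k \<notin> S \<and> l \<notin> S. D S)"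
    for i j k l
  have two: "2 \<le> card T" if "finite T" "i \<in> T" "j \<in> T" "i \<noteq> j" for T and i j :: nat
    using card_mono [of T "{i, j}"] that by simp
  have s: "s i j k l = - (\<Sum>S | S \<subseteq> ?N \<and> i \<in> S \<and> j \<in> S \<and> k \<in> S \<and> l \<notin> S. D S)"
    if "{i, j, k, l} \<subseteq> ?N" "distinct [i, j, k, l]" for i j k l
  proof -
    have "T \<in> keel_generators n"
      if T: "T \<subseteq> ?N" "i \<in> T" "j \<in> T" "k \<notin> T" "l \<notin> T" for T
    proof -
      have "finite T" using T finite_subset by blast
      then have "2 \<le> card T" "2 \<le> card (?N - T)"
        using \<open>{i, j, k, l} \<subseteq> ?N\<close> \<open>distinct [i, j, k, l]\<close> T two [of T i j] two [of "?N - T" k l] by auto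
      moreover have "card (?N - T) = n + 1 - card T"
        using T \<open>finite T\<close> by (subst card_Diff_subset) auto
      ultimately show ?thesis
        using T by (auto simp: keel_generators_def)
    qed
    then have "{S. S \<in> keel_generators n \<and> i \<in> S \<and> j \<in> S \<and> k \<notin> S \<and> l \<notin> S} =
        {S. S \<subseteq> ?N \<and> i \<in> S \<and> j \<in> S \<and> k \<notin> S \<and> l \<notin> S}"
      by (auto simp: keel_generators_def)
    then have "s i j k l + (\<Sum>S | S \<subseteq> ?N \<and> i \<in> S \<and> j \<in> S \<and> k \<in> S \<and> l \<notin> S. D S) =
      (\<Sum>S\<in>{S. S \<subseteq> ?N \<and> i \<in> S \<and> j \<in> S \<and> k \<notin> S \<and> l \<notin> S} \<union>
        {S. S \<subseteq> ?N \<and> i \<in> S \<and> j \<in> S \<and> k \<in> S \<and> l \<notin> S}. D S)"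
      unfolding s_def by (subst sum.union_disjoint) auto
    also have "{S. S \<subseteq> ?N \<and> i \<in> S \<and> j \<in> S \<and> k \<notin> S \<and> l \<notin> S} \<union>
        {S. S \<subseteq> ?N \<and> i \<in> S \<and> j \<in> S \<and> k \<in> S \<and> l \<notin> S} = {S. S \<subseteq> ?N \<and> i \<in> S \<and> j \<in> S \<and> l \<notin> S}"
      by auto
    also have "sum D \<dots> = 0"
      using that by (intro linear) auto
    finally show ?thesis
      by (simp add: eq_neg_iff_add_eq_0)
  qed
  have s_swap: "s i j k l = s i j l k" for i j k l
    by (simp add: s_def conj_ac)
  have s_exchange: "s i j k l = s i k j l"
    if "{i, j, k, l} \<subseteq> ?N" "distinct [i, j, k, l]" for i j k l
  proof -
    have "{S. S \<subseteq> ?N \<and> i \<in> S \<and> j \<in> S \<and> k \<in> S \<and> l \<notin> S} =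
        {S. S \<subseteq> ?N \<and> i \<in> S \<and> k \<in> S \<and> j \<in> S \<and> l \<notin> S}"
      by auto
    then show ?thesis
      using that s [of i j k l] s [of i k j l] by auto
  qed
  have s_exchange': "s i k j l = s i l j k"
    if "{i, j, k, l} \<subseteq> ?N" "distinct [i, j, k, l]" for i j k l
    using that s_exchange [of i k l j] s_swap [of i k j l] s_swap [of i l k j] by auto
  show "r = 0" if r: "r \<in> keel_relations D n"
  proof -
    have "r \<in> {D S - D (?N - S) | S. S \<in> keel_generators n}
      \<union> {s i j k l - s i k j l | i j k l. {i, j, k, l} \<subseteq> ?N \<and> distinct [i, j, k, l]}
      \<union> {s i k j l - s i l j k | i j k l. {i, j, k, l} \<subseteq> ?N \<and> distinct [i, j, k, l]}
      \<union> {D S * D T | S T. S \<in> keel_generators n \<and> T \<in> keel_generators n \<and>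
           S \<inter> T \<noteq> {} \<and> S - T \<noteq> {} \<and> T - S \<noteq> {} \<and> ?N - (S \<union> T) \<noteq> {}}"
      using r unfolding keel_relations_def Let_def s_def .
    then show ?thesis
    proof (elim UnE CollectE exE conjE)
      fix S assume "r = D S - D (?N - S)" "S \<in> keel_generators n"
      then show ?thesis
        using Compl [of S] by (simp add: keel_generators_def)
    next
      fix i j k l
      assume "r = s i j k l - s i k j l" "{i, j, k, l} \<subseteq> ?N" "distinct [i, j, k, l]"
      then show ?thesis
        using s_exchange [of i j k l] by simp
    next
      fix i j k l
      assume "r = s i k j l - s i l j k" "{i, j, k, l} \<subseteq> ?N" "distinct [i, j, k, l]"
      then show ?thesis
        using s_exchange' [of i j k l] by simp
    next
      fix S T
      assume "r = D S * D T" "S \<in> keel_generators n" "T \<in> keel_generators n" "S \<inter> T \<noteq> {}"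
        "S - T \<noteq> {}" "T - S \<noteq> {}" "?N - (S \<union> T) \<noteq> {}"
      then show ?thesis
        using crossing [of S T] by (simp add: keel_generators_def)
    qed
  qed
  show "r = 0" if r: "r \<in> dcp_relations D n"
  proof -
    have "r \<in> {(\<Sum>S | S \<in> dcp_generators n \<and> i \<in> S \<and> j \<in> S. D S) | i j.
        i \<in> {1..n} \<and> j \<in> {1..n} \<and> i \<noteq> j}
      \<union> {D S * D T | S T. S \<in> dcp_generators n \<and> T \<in> dcp_generators n \<and>
           S \<inter> T \<noteq> {} \<and> \<not> S \<subseteq> T \<and> \<not> T \<subseteq> S}"
      using r unfolding dcp_relations_def Let_def .
    then show ?thesis
    proof (elim UnE CollectE exE conjE)
      fix i j
      assume ij: "i \<in> {1..n}" "j \<in> {1..n}" "i \<noteq> j"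
        and r: "r = (\<Sum>S | S \<in> dcp_generators n \<and> i \<in> S \<and> j \<in> S. D S)"
      have "T \<in> dcp_generators n \<longleftrightarrow> T \<subseteq> ?N \<and> n + 1 \<notin> T" if T: "i \<in> T" "j \<in> T" for T
      proof
        assume *: "T \<subseteq> ?N \<and> n + 1 \<notin> T"
        then have "T \<subseteq> {1..n}"
          by (auto simp: subset_iff) (metis le_SucE)
        then show "T \<in> dcp_generators n"
          using two [of T i j] card_mono [of "{1..n}" T] finite_subset [of T "{1..n}"] ij T
          by (simp add: dcp_generators_def)
      qed (auto simp: dcp_generators_def)
      then have "{S. S \<in> dcp_generators n \<and> i \<in> S \<and> j \<in> S} = {S. S \<subseteq> ?N \<and> i \<in> S \<and> j \<in> S \<and> n + 1 \<notin> S}"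
        by blast
      with ij r show ?thesis
        using linear [of i j "n + 1"] by simp
    next
      fix S T
      assume ST: "S \<in> dcp_generators n" "T \<in> dcp_generators n" "S \<inter> T \<noteq> {}"
        "\<not> S \<subseteq> T" "\<not> T \<subseteq> S" "r = D S * D T"
      then have "S \<subseteq> {1..n}" "T \<subseteq> {1..n}"
        by (auto simp: dcp_generators_def)
      then have "n + 1 \<in> ?N - (S \<union> T)" "S \<subseteq> ?N" "T \<subseteq> ?N"
        by auto
      with ST show ?thesis
        using crossing [of S T] by blast
    qed
  qed
qed

text \<open>
  The fibres of \<open>f\<close> are five blocks of marked points. The condition \<open>T = {x \<in> N. f x \<in> f ` T}\<close>
  says that \<open>T\<close> is a union of blocks.
\<close>

definition block_class :: "(nat \<Rightarrow> 5) \<Rightarrow> nat set \<Rightarrow> nat set \<Rightarrow> 5 \<Rightarrow> int"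
  where "block_class f N T = (if T = {x \<in> N. f x \<in> f ` T} then sign_vector (f ` T) else (\<lambda>_. 0))"

context
  fixes f :: "nat \<Rightarrow> 5" and N :: "nat set"
  assumes finite_N: "finite N" and surj: "f ` N = UNIV"
begin

lemma image_union_of_blocks: "f ` {x \<in> N. f x \<in> U} = U"
proof -
  have "f ` {x \<in> N. f x \<in> U} = f ` N \<inter> U" by blast
  then show ?thesis by (simp add: surj)
qed

lemma block_class_union_of_blocks: "block_class f N {x \<in> N. f x \<in> U} = sign_vector U"
  by (simp add: block_class_def image_union_of_blocks)

lemma block_class_cases:
  obtains U where "T = {x \<in> N. f x \<in> U}" | "block_class f N T = (\<lambda>_. 0)"
  by (metis block_class_def)

lemma sum_block_class_eq_0:
  assumes "{i, j, e} \<subseteq> N"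
  shows "(\<Sum>T | T \<subseteq> N \<and> i \<in> T \<and> j \<in> T \<and> e \<notin> T. block_class f N T p) = 0"
proof -
  let ?pre = "\<lambda>U. {x \<in> N. f x \<in> U}"
  have inj: "inj_on ?pre B" for B
    by (rule inj_onI) (metis image_union_of_blocks)
  have "(\<Sum>T | T \<subseteq> N \<and> i \<in> T \<and> j \<in> T \<and> e \<notin> T. block_class f N T p) =
      (\<Sum>T\<in>?pre ` {U. f i \<in> U \<and> f j \<in> U \<and> f e \<notin> U}. block_class f N T p)"
  proof (rule sum.mono_neutral_right)
    show "\<forall>T\<in>{T. T \<subseteq> N \<and> i \<in> T \<and> j \<in> T \<and> e \<notin> T} - ?pre ` {U. f i \<in> U \<and> f j \<in> U \<and> f e \<notin> U}.
        block_class f N T p = 0"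
    proof
      fix T assume T: "T \<in> {T. T \<subseteq> N \<and> i \<in> T \<and> j \<in> T \<and> e \<notin> T} - ?pre ` {U. f i \<in> U \<and> f j \<in> U \<and> f e \<notin> U}"
      show "block_class f N T p = 0"
      proof (cases T rule: block_class_cases)
        case (1 U)
        with T assms have "f i \<in> U \<and> f j \<in> U \<and> f e \<notin> U" by auto
        with T 1 show ?thesis by blast
      qed simp
    qed
  qed (use finite_N assms in auto)
  also have "\<dots> = (\<Sum>U | f i \<in> U \<and> f j \<in> U \<and> f e \<notin> U. sign_vector U p)"
    by (simp add: sum.reindex [OF inj] block_class_union_of_blocks)
  also have "\<dots> = 0"
    by (rule sum_sign_vector_eq_0)
  finally show ?thesis .
qed

lemma block_class_Compl:
  assumes "T \<subseteq> N"
  shows "block_class f N (N - T) = block_class f N T"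
proof -
  have *: "N - {x \<in> N. f x \<in> U} = {x \<in> N. f x \<in> - U}" for U by auto
  have TN: "T = N - (N - T)" using assms by auto
  show ?thesis
  proof (cases T rule: block_class_cases)
    case (1 U)
    then show ?thesis
      by (simp only: * block_class_union_of_blocks sign_vector_Compl)
  next
    case 2
    show ?thesis
    proof (cases "N - T" rule: block_class_cases)
      case (1 U)
      with TN have "T = {x \<in> N. f x \<in> - U}" by (metis *)
      with 1 show ?thesis
        by (simp only: block_class_union_of_blocks sign_vector_Compl)
    qed (simp add: 2)
  qed
qed

lemma form_block_class_crossing:
  assumes "S \<inter> T \<noteq> {}" "S - T \<noteq> {}" "T - S \<noteq> {}" "N - (S \<union> T) \<noteq> {}"
  shows "form (block_class f N S) (block_class f N T) = 0"
proof (cases S rule: block_class_cases)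
  case (1 U)
  show ?thesis
  proof (cases T rule: block_class_cases)
    case (1 W)
    have "U \<inter> W \<noteq> {}" "U - W \<noteq> {}" "W - U \<noteq> {}" "U \<union> W \<noteq> UNIV"
      using assms unfolding \<open>S = {x \<in> N. f x \<in> U}\<close> 1 by auto
    then show ?thesis
      unfolding \<open>S = {x \<in> N. f x \<in> U}\<close> 1 block_class_union_of_blocks
      by (rule form_sign_vector_crossing)
  qed simp
qed simp

end

text \<open>
  Choose five points, at least one in \<open>S\<close> and at least one outside, to represent the blocks.
  The remaining points of \<open>S\<close> join the block of a chosen point \<open>a\<close> of \<open>S\<close>, and those outside \<open>S\<close>
  the block of a chosen point \<open>b\<close> outside.
\<close>

lemma ex_blocks:
  assumes "finite N" "5 \<le> card N" "S \<subset> N" "S \<noteq> {}"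
  obtains f :: "nat \<Rightarrow> 5" and U where "f ` N = UNIV" "S = {x \<in> N. f x \<in> U}"
proof -
  obtain a b where ab: "a \<in> S" "b \<in> N" "b \<notin> S"
    using assms by blast
  then have "a \<noteq> b" "{a, b} \<subseteq> N"
    using assms by auto
  then have "card (N - {a, b}) = card N - 2"
    by (subst card_Diff_subset) auto
  then have "3 \<le> card (N - {a, b})"
    using assms by simp
  then obtain Q where Q: "Q \<subseteq> N - {a, b}" "card Q = 3" "finite Q"
    by (metis obtain_subset_with_card_n)
  define P where "P = insert a (insert b Q)"
  have "card P = 5"
    using Q ab by (auto simp: P_def card_insert_if)
  have P: "finite P" "P \<subseteq> N" "a \<in> P" "b \<in> P"
    using Q ab assms by (auto simp: P_def)
  obtain h :: "nat \<Rightarrow> 5" where h: "bij_betw h P UNIV"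
    using finite_same_card_bij [OF P(1), of "UNIV :: 5 set"] \<open>card P = 5\<close> by auto
  define r where "r x = (if x \<in> P then x else if x \<in> S then a else b)" for x
  have r: "r x \<in> P" "r x \<in> S \<longleftrightarrow> x \<in> S" for x
    using P ab by (auto simp: r_def)
  have "r ` N = P"
    using P r by (auto simp: r_def)
  then have "(h \<circ> r) ` N = UNIV"
    using h by (metis bij_betw_imp_surj_on image_comp)
  moreover have "h (r x) \<in> h ` (P \<inter> S) \<longleftrightarrow> x \<in> S" for x
    using r [of x] h by (auto simp: bij_betw_def inj_on_def)
  then have "S = {x \<in> N. (h \<circ> r) x \<in> h ` (P \<inter> S)}"
    using assms by auto
  ultimately show ?thesis by (rule that)
qed

lemma sum_Form_Ring: "(\<Sum>x\<in>B. Form_Ring 0 (v x) 0) = Form_Ring 0 (\<lambda>i. \<Sum>x\<in>B. v x i) 0"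
  by (induction B rule: infinite_finite_induct) (simp_all add: zero_form_ring_def)

text \<open>
  The generator of \<open>S\<close> is sent to a sign vector, which has nonzero square, because the blocks are
  chosen to make \<open>S\<close> a union of blocks. Five nonempty blocks require \<open>n + 1 \<ge> 5\<close> points.
\<close>

lemma ex_realization:
  assumes "n \<ge> 4" "S \<subset> {1..n+1}" "S \<noteq> {}"
  obtains D :: "nat set \<Rightarrow> form_ring" where "D S * D S \<noteq> 0"
    "\<And>r. r \<in> keel_relations D n \<Longrightarrow> r = 0" "\<And>r. r \<in> dcp_relations D n \<Longrightarrow> r = 0"
proof -
  let ?N = "{1..n+1}"
  obtain f :: "nat \<Rightarrow> 5" and U where f: "f ` ?N = UNIV" and S: "S = {x \<in> ?N. f x \<in> U}"
    using ex_blocks [of ?N S] assms by auto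
  define D where "D T = Form_Ring 0 (block_class f ?N T) 0" for T
  have "block_class f ?N S = sign_vector U"
    unfolding S by (rule block_class_union_of_blocks [OF finite_atLeastAtMost f])
  then have square: "D S * D S \<noteq> 0"
    by (simp add: D_def form_sign_vector_self zero_form_ring_def)
  have linear: "(\<Sum>T | T \<subseteq> ?N \<and> i \<in> T \<and> j \<in> T \<and> e \<notin> T. D T) = 0" if "{i, j, e} \<subseteq> ?N" for i j e
    unfolding D_def sum_Form_Ring sum_block_class_eq_0 [OF finite_atLeastAtMost f that] zero_form_ring_def ..
  have Compl: "D (?N - T) = D T" if "T \<subseteq> ?N" for T
    unfolding D_def block_class_Compl [OF finite_atLeastAtMost f that] ..
  have crossing: "D S * D T = 0"
    if "S \<subseteq> ?N" "T \<subseteq> ?N" "S \<inter> T \<noteq> {}" "S - T \<noteq> {}" "T - S \<noteq> {}" "?N - (S \<union> T) \<noteq> {}"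
    for S T
    using form_block_class_crossing [OF finite_atLeastAtMost f that(3-6)] by (simp add: D_def zero_form_ring_def)
  show ?thesis
  proof (rule that [of D])
    show "r = 0" if "r \<in> keel_relations D n" for r
      by (rule keel_relations_vanish [of n D]) (fact linear Compl crossing that)+
    show "r = 0" if "r \<in> dcp_relations D n" for r
      by (rule dcp_relations_vanish [of n D]) (fact linear Compl crossing that)+
  qed (fact square)
qed

section \<open>The least generator and Groebner bases\<close>

definition monomial_power :: "'m::monoid_add \<Rightarrow> nat \<Rightarrow> 'm"
  where "monomial_power m k = ((+) m ^^ k) 0"

lemma monomial_power_simps [simp]:
  "monomial_power m 0 = 0"
  "monomial_power m (Suc k) = m + monomial_power m k"
  by (simp_all add: monomial_power_def)

lemma frag_of_power: "frag_of m ^ k = frag_of (monomial_power m k)"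
  by (induction k) (simp_all add: mult_single)

text \<open>
  The properties shared by exponent vectors and words on which the argument depends. The last one
  says that every divisor of a power of a generator is a power of the same generator.
\<close>

locale generated_monomials =
  fixes X :: "'x set" and M :: "'m::monoid_add set" and var :: "'x \<Rightarrow> 'm" and wt :: "'m \<Rightarrow> nat"
  assumes zero_mem: "0 \<in> M"
    and add_mem: "\<And>u v. u \<in> M \<Longrightarrow> v \<in> M \<Longrightarrow> u + v \<in> M"
    and var_mem: "\<And>x. x \<in> X \<Longrightarrow> var x \<in> M"
    and monomial_induct [consumes 1, case_names zero add]: "\<And>m P. m \<in> M \<Longrightarrow> P 0
      \<Longrightarrow> (\<And>x u. x \<in> X \<Longrightarrow> u \<in> M \<Longrightarrow> P u \<Longrightarrow> P (var x + u)) \<Longrightarrow> P m"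
    and wt_zero: "wt 0 = 0"
    and wt_var_add: "\<And>x u. wt (var x + u) = Suc (wt u)"
    and divides_power: "\<And>x k m. monomial_divides M m (monomial_power (var x) k)
      \<Longrightarrow> m = monomial_power (var x) (wt m)"
begin

abbreviation gen :: "'x \<Rightarrow> ('m \<Rightarrow>\<^sub>0 int)"
  where "gen x \<equiv> frag_of (var x)"

abbreviation ideal :: "('m \<Rightarrow>\<^sub>0 int) set \<Rightarrow> ('m \<Rightarrow>\<^sub>0 int) set"
  where "ideal R \<equiv> two_sided_ideal (polynomials M) R"

lemma frag_of_closed: "m \<in> M \<Longrightarrow> frag_of m \<in> polynomials M"
  by (simp add: polynomials_def)

lemma polynomials_one: "1 \<in> polynomials M"
  using zero_mem by (simp add: polynomials_def)

lemma polynomials_diff: "p \<in> polynomials M \<Longrightarrow> q \<in> polynomials M \<Longrightarrow> p - q \<in> polynomials M"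
  using keys_diff [of p q] by (auto simp: polynomials_def)

lemma polynomials_add: "p \<in> polynomials M \<Longrightarrow> q \<in> polynomials M \<Longrightarrow> p + q \<in> polynomials M"
  using Poly_Mapping.keys_add [of p q] by (auto simp: polynomials_def)

lemma polynomials_mult: "p \<in> polynomials M \<Longrightarrow> q \<in> polynomials M \<Longrightarrow> p * q \<in> polynomials M"
  using keys_mult [of p q] by (force simp: polynomials_def intro: add_mem)

lemma polynomials_sum: "(\<And>x. x \<in> B \<Longrightarrow> f x \<in> polynomials M) \<Longrightarrow> (\<Sum>x\<in>B. f x) \<in> polynomials M"
  by (induction B rule: infinite_finite_induct)
    (simp_all add: polynomials_add, simp_all add: polynomials_def)

lemma polynomials_zero: "0 \<in> polynomials M"
  by (simp add: polynomials_def)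

lemma ideal_add:
  assumes "p \<in> ideal R" "q \<in> ideal R"
  shows "p + q \<in> ideal R"
  using assms(2)
proof induction
  case (add q a r b)
  then show ?case
    using two_sided_ideal.add [of "p + q" "polynomials M" R a r b] by (simp add: add.assoc)
qed (use assms in simp)

lemma ideal_mult:
  assumes "c \<in> polynomials M" "p \<in> ideal R"
  shows "c * p \<in> ideal R" and "p * c \<in> ideal R"
  using assms(2)
proof (induction p rule: two_sided_ideal.induct)
  case (add p a r b)
  {
    case 1
    show ?case
      using two_sided_ideal.add [OF add.IH(1), of "c * a" r b] add.hyps assms
      by (simp add: distrib_left mult.assoc polynomials_mult)
  next
    case 2
    show ?case
      using two_sided_ideal.add [OF add.IH(2), of a r "b * c"] add.hyps assms
      by (simp add: distrib_right mult.assoc polynomials_mult)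
  }
qed (simp_all add: two_sided_ideal.zero)

lemma relation_in_ideal: "r \<in> R \<Longrightarrow> r \<in> ideal R"
  using two_sided_ideal.add [OF two_sided_ideal.zero, of 1 "polynomials M" r R 1]
  by (simp add: polynomials_one)

lemma ideal_subset_polynomials:
  assumes "R \<subseteq> polynomials M"
  shows "ideal R \<subseteq> polynomials M"
proof
  fix p assume "p \<in> ideal R"
  then show "p \<in> polynomials M"
    by induction (use assms in \<open>auto intro!: polynomials_add polynomials_mult polynomials_zero\<close>)
qed

lemma ideal_uminus: "p \<in> ideal R \<Longrightarrow> - p \<in> ideal R"
  using ideal_mult(1) [OF polynomials_diff [OF polynomials_zero polynomials_one]] by fastforce

text \<open>
  Commutators of generators suffice because taking the commutator with a fixed element is a
  derivation, and because the commutator is additive in both arguments.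
\<close>

lemma commuting_ideal:
  assumes R: "R \<subseteq> polynomials M"
    and comm: "commutators gen X \<subseteq> ideal R"
  shows "commuting_ideal (polynomials M) (ideal R)"
proof
  let ?C = "\<lambda>p q. p * q - q * p \<in> ideal R"
  have gen_gen: "?C (gen x) (gen y)" if "x \<in> X" "y \<in> X" for x y
    using comm that unfolding commutators_def by blast
  have step: "?C (gen x * p) q" if "x \<in> X" "p \<in> polynomials M" "q \<in> polynomials M"
    "?C (gen x) q" "?C p q" for x p q
  proof -
    have "gen x * (p * q - q * p) + (gen x * q - q * gen x) * p \<in> ideal R"
      using that by (intro ideal_add ideal_mult frag_of_closed var_mem)
    then show ?thesis by (simp add: algebra_simps)
  qed
  have skew: "?C p q" if "?C q p" for p q
    using ideal_uminus [OF that] by simp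
  have gen_monomial: "?C (gen x) (frag_of m)" if "x \<in> X" "m \<in> M" for x m
    using that(2)
  proof (induction m rule: monomial_induct)
    case (add y u)
    have "?C (gen y * frag_of u) (gen x)"
      by (rule step [OF add(1) frag_of_closed [OF add(2)] frag_of_closed [OF var_mem [OF that(1)]]
            gen_gen [OF add(1) that(1)] skew [OF add(3)]])
    from skew [OF this] show ?case
      by (simp add: mult_single)
  qed (simp add: two_sided_ideal.zero)
  have monomials: "?C (frag_of m) (frag_of w)" if "m \<in> M" "w \<in> M" for m w
    using that(1)
  proof (induction m rule: monomial_induct)
    case (add y u)
    have "?C (gen y * frag_of u) (frag_of w)"
      by (rule step [OF add(1) frag_of_closed [OF add(2)] frag_of_closed [OF that(2)]
            gen_monomial [OF add(1) that(2)] add(3)])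
    then show ?case
      by (simp add: mult_single)
  qed (simp add: two_sided_ideal.zero)
  have commutator_diff: "?C (p - p') q" if "?C p q" "?C p' q" for p p' q
    using ideal_add [OF that(1) ideal_uminus [OF that(2)]] by (simp add: algebra_simps)
  have monomial_polynomial: "?C (frag_of m) q" if "m \<in> M" "q \<in> polynomials M" for m q
    using that(2) [unfolded polynomials_def, THEN CollectD]
  proof (induction q rule: frag_induction)
    case (one w)
    show ?case by (rule monomials [OF that(1) one])
  next
    case (diff q q')
    show ?case by (rule skew [OF commutator_diff [OF skew [OF diff.IH(1)] skew [OF diff.IH(2)]]])
  qed (simp add: two_sided_ideal.zero)
  show "?C p q" if "p \<in> polynomials M" "q \<in> polynomials M" for p q
    using that(1) [unfolded polynomials_def, THEN CollectD]
  proof (induction p rule: frag_induction)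
    case (one w)
    show ?case by (rule monomial_polynomial [OF one that(2)])
  next
    case (diff p p')
    show ?case by (rule commutator_diff [OF diff.IH])
  qed (simp add: two_sided_ideal.zero)
qed (use R in \<open>auto intro: polynomials_one polynomials_diff polynomials_mult two_sided_ideal.zero
    ideal_add ideal_mult subsetD [OF ideal_subset_polynomials]\<close>)

lemma leading_monomial_max:
  assumes ord: "admissible_ordering M ord" and p: "p \<in> polynomials M" "p \<noteq> 0"
  shows "leading_monomial ord p \<in> Poly_Mapping.keys p"
    and "k \<in> Poly_Mapping.keys p \<Longrightarrow> (k, leading_monomial ord p) \<in> ord"
proof -
  have "linear_order_on M ord"
    using ord by (simp add: admissible_ordering_def well_order_on_def)
  then have ord': "refl_on M ord" "trans ord" "antisym ord" "total_on M ord"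
    by (simp_all add: linear_order_on_def partial_order_on_def preorder_on_def)
  have max: "K \<subseteq> M \<Longrightarrow> \<exists>m\<in>K. \<forall>k\<in>K. (k, m) \<in> ord" if "finite K" "K \<noteq> {}" for K
    using that
  proof (induction rule: finite_ne_induct)
    case (singleton x)
    then show ?case
      using ord'(1) by (simp add: refl_on_def)
  next
    case (insert x F)
    then obtain m where m: "m \<in> F" "\<forall>k\<in>F. (k, m) \<in> ord" by blast
    have refl: "(x, x) \<in> ord"
      using insert.prems ord'(1) by (simp add: refl_on_def)
    have "(x, m) \<in> ord \<or> (m, x) \<in> ord"
      using insert.prems m ord'(4) refl by (auto simp: total_on_def)
    then show ?case
    proof
      assume "(m, x) \<in> ord"
      then have "\<forall>k\<in>insert x F. (k, x) \<in> ord"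
        using m refl ord'(2) by (blast dest: transD)
      then show ?thesis by blast
    qed (use m in blast)
  qed
  obtain m where m: "m \<in> Poly_Mapping.keys p" "\<forall>k\<in>Poly_Mapping.keys p. (k, m) \<in> ord"
    using max [of "Poly_Mapping.keys p"] p by (auto simp: polynomials_def)
  have "leading_monomial ord p = m"
    unfolding leading_monomial_def using m ord'(3) by (intro the_equality) (auto dest: antisymD)
  with m show "leading_monomial ord p \<in> Poly_Mapping.keys p"
    and "k \<in> Poly_Mapping.keys p \<Longrightarrow> (k, leading_monomial ord p) \<in> ord"
    by simp_all
qed

lemma ex_least_generator:
  assumes ord: "admissible_ordering M ord" and "X \<noteq> {}"
  obtains z where "z \<in> X" "\<And>x. x \<in> X \<Longrightarrow> (var z, var x) \<in> ord"
proof -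
  have wo: "well_order_on M ord"
    using ord by (simp add: admissible_ordering_def)
  then have lin: "linear_order_on M ord" and wf: "wf (ord - Id)"
    by (simp_all add: well_order_on_def)
  obtain x where "x \<in> X" using \<open>X \<noteq> {}\<close> by blast
  then obtain v where v: "v \<in> var ` X" "\<And>w. (w, v) \<in> ord - Id \<Longrightarrow> w \<notin> var ` X"
    using wfE_min [OF wf, of "var x" "var ` X"] by blast
  then obtain z where z: "z \<in> X" "v = var z" by blast
  have "(var z, var x) \<in> ord" if "x \<in> X" for x
  proof (cases "var x = var z")
    case True
    with lin var_mem [OF that] show ?thesis
      by (auto simp: linear_order_on_def partial_order_on_def preorder_on_def refl_on_def)
  next
    case False
    moreover have "(var x, var z) \<notin> ord"
      using v(2) [of "var x"] that False z by blast
    ultimately show ?thesis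
      using lin z var_mem [OF z(1)] var_mem [OF that] False by (auto simp: linear_order_on_def total_on_def)
  qed
  with z that show ?thesis by blast
qed

lemma ordering_mono:
  assumes ord: "admissible_ordering M ord" and M: "{u, u', v, v'} \<subseteq> M"
    and "(u, u') \<in> ord" "(v, v') \<in> ord"
  shows "(u + v, u' + v') \<in> ord"
proof -
  have lin: "linear_order_on M ord"
    using ord by (simp add: admissible_ordering_def well_order_on_def)
  then have refl: "(w, w) \<in> ord" if "w \<in> M" for w
    using that by (simp add: linear_order_on_def partial_order_on_def preorder_on_def refl_on_def)
  have "(u + v, u' + v) \<in> ord"
    using assms refl [OF add_mem [of u v]] by (cases "u = u'") (auto simp: admissible_ordering_def)
  moreover have "(u' + v, u' + v') \<in> ord"
    using assms refl [OF add_mem [of u' v]] by (cases "v = v'") (auto simp: admissible_ordering_def)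
  ultimately show ?thesis
    using lin by (meson linear_order_on_def partial_order_on_def preorder_on_def transD)
qed

text \<open>
  Replacing each factor of a monomial by the least generator can only decrease the monomial.
\<close>

lemma power_least:
  assumes ord: "admissible_ordering M ord" and z: "z \<in> X" "\<And>x. x \<in> X \<Longrightarrow> (var z, var x) \<in> ord"
    and m: "m \<in> M"
  shows "(monomial_power (var z) (wt m), m) \<in> ord"
proof -
  have power: "monomial_power (var z) k \<in> M" for k
    by (induction k) (simp_all add: zero_mem add_mem var_mem z)
  show ?thesis
    using m
  proof (induction m rule: monomial_induct)
    case zero
    have "linear_order_on M ord"
      using ord by (simp add: admissible_ordering_def well_order_on_def)
    then show ?case
      by (simp add: wt_zero zero_mem linear_order_on_def partial_order_on_def preorder_on_def refl_on_def)
  next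
    case (add x u)
    then show ?case
      using z power by (auto simp: wt_var_add var_mem intro!: ordering_mono [OF ord])
  qed
qed

lemma no_linear_and_quadratic_groebner_basis:
  assumes ord: "admissible_ordering M ord" and "X \<noteq> {}"
    and R: "R \<subseteq> polynomials M"
    and nilpotent: "\<And>x. x \<in> X \<Longrightarrow> \<exists>k. gen x ^ k \<in> ideal R"
    and square: "\<And>x. x \<in> X \<Longrightarrow> gen x * gen x \<notin> ideal R"
  shows "\<not> (\<exists>G. groebner_basis M ord (ideal R) G \<and> linear_and_quadratic wt G)"
proof
  assume "\<exists>G. groebner_basis M ord (ideal R) G \<and> linear_and_quadratic wt G"
  then obtain G where G: "groebner_basis M ord (ideal R) G" "linear_and_quadratic wt G" by blast
  obtain z where z: "z \<in> X" "\<And>x. x \<in> X \<Longrightarrow> (var z, var x) \<in> ord"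
    using ex_least_generator [OF ord \<open>X \<noteq> {}\<close>] by blast
  obtain k where k: "frag_of (monomial_power (var z) k) \<in> ideal R"
    using nilpotent [OF z(1)] by (auto simp: frag_of_power)
  have poly: "ideal R \<subseteq> polynomials M"
    by (rule ideal_subset_polynomials [OF R])
  have "leading_monomial ord (frag_of (monomial_power (var z) k)) = monomial_power (var z) k"
    using leading_monomial_max(1) [OF ord subsetD [OF poly k]] by simp
  then obtain g where g: "g \<in> G" and "monomial_divides M (leading_monomial ord g) (monomial_power (var z) k)"
    using G(1) k unfolding groebner_basis_def by force
  then have lm: "leading_monomial ord g = monomial_power (var z) (wt (leading_monomial ord g))"
    using divides_power by blast
  let ?m = "leading_monomial ord g"
  have gI: "g \<in> ideal R" and coeff: "Poly_Mapping.lookup g ?m = 1"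
    using G(1) g unfolding groebner_basis_def leading_coeff_def by auto
  have gM: "g \<in> polynomials M" and "g \<noteq> 0"
    using gI poly coeff by auto
  \<comment> \<open>The leading monomial is the greatest one of \<open>g\<close> and, being a power of \<open>z\<close>, also the least
    one of its weight. Hence \<open>g\<close> has no other monomial.\<close>
  have keys: "Poly_Mapping.keys g = {?m}"
  proof (intro equalityI subsetI)
    fix m assume m: "m \<in> Poly_Mapping.keys g"
    have "?m \<in> Poly_Mapping.keys g"
      using coeff by (simp add: in_keys_iff)
    with m G(2) g have "wt m = wt ?m"
      by (auto simp: linear_and_quadratic_def homogeneous_def)
    moreover have "m \<in> M"
      using gM m by (auto simp: polynomials_def)
    ultimately have "(?m, m) \<in> ord"
      using power_least [OF ord z, of m] lm by simp
    moreover have "(m, ?m) \<in> ord"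
      using leading_monomial_max(2) [OF ord gM \<open>g \<noteq> 0\<close> m] .
    ultimately show "m \<in> {?m}"
      using ord
      by (auto simp: admissible_ordering_def well_order_on_def linear_order_on_def
          partial_order_on_def dest: antisymD)
  qed (use coeff in \<open>simp add: in_keys_iff\<close>)
  have "g = frag_of ?m"
    by (rule poly_mapping_eqI) (metis coeff keys in_keys_iff lookup_single_eq lookup_single_not_eq singletonD)
  also have "\<dots> = gen z ^ wt ?m"
    by (subst lm) (simp add: frag_of_power)
  finally have "gen z ^ wt ?m \<in> ideal R"
    using gI by simp
  moreover have "wt ?m = 1 \<or> wt ?m = 2"
    using G(2) g keys by (auto simp: linear_and_quadratic_def homogeneous_def)
  ultimately have "gen z * gen z \<in> ideal R"
    using ideal_mult(1) [OF frag_of_closed [OF var_mem [OF z(1)]]] by (auto simp: power2_eq_square)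
  with square [OF z(1)] show False by contradiction
qed

end

section \<open>Commutative and noncommutative monomials\<close>

lemma comm_weight_superset:
  assumes "finite K" "Poly_Mapping.keys m \<subseteq> K"
  shows "comm_weight m = (\<Sum>x\<in>K. Poly_Mapping.lookup m x)"
  unfolding comm_weight_def using assms
  by (intro sum.mono_neutral_left) (auto simp: in_keys_iff)

lemma comm_weight_single_add:
  "comm_weight (Poly_Mapping.single x 1 + m) = Suc (comm_weight m)"
proof -
  let ?K = "insert x (Poly_Mapping.keys m)"
  have "comm_weight (Poly_Mapping.single x 1 + m) =
      (\<Sum>y\<in>?K. Poly_Mapping.lookup (Poly_Mapping.single x 1 + m) y)"
    using keys_add [of "Poly_Mapping.single x 1" m] by (intro comm_weight_superset) auto
  also have "\<dots> = (\<Sum>y\<in>?K. (if y = x then 1 else 0)) + (\<Sum>y\<in>?K. Poly_Mapping.lookup m y)"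
    by (simp only: lookup_add sum.distrib) (simp add: lookup_single when_def eq_commute [of x])
  also have "\<dots> = Suc (comm_weight m)"
    by (subst comm_weight_superset [of ?K m]) (auto simp: sum.delta)
  finally show ?thesis .
qed

lemma comm_monomial_power: "monomial_power (Poly_Mapping.single x 1) k = Poly_Mapping.single x k"
  by (induction k) (simp_all flip: single_add)

lemma nc_monomial_power: "monomial_power (NCMonomial [x]) k = NCMonomial (replicate k x)"
  by (induction k) (simp_all add: zero_nc_monomial_def plus_nc_monomial_def)

lemma generated_comm_monomials:
  "generated_monomials X (comm_monomials X) (\<lambda>x. Poly_Mapping.single x 1) comm_weight"
proof
  fix m :: "'a \<Rightarrow>\<^sub>0 nat" and P
  assume "m \<in> comm_monomials X" and zero: "P 0"
    and add: "\<And>x u. x \<in> X \<Longrightarrow> u \<in> comm_monomials X \<Longrightarrow> P u \<Longrightarrow> P (Poly_Mapping.single x 1 + u)"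
  then show "P m"
  proof (induction "comm_weight m" arbitrary: m rule: less_induct)
    case less
    show ?case
    proof (cases "m = 0")
      case False
      then obtain x where x: "x \<in> Poly_Mapping.keys m"
        by (auto simp: poly_mapping_eq_iff fun_eq_iff in_keys_iff)
      define u where "u = m - Poly_Mapping.single x 1"
      have m: "m = Poly_Mapping.single x 1 + u"
        using x by (intro poly_mapping_eqI)
          (auto simp: u_def lookup_add minus_poly_mapping.rep_eq lookup_single when_def in_keys_iff)
      have "Poly_Mapping.keys u \<subseteq> Poly_Mapping.keys m"
        by (auto simp: u_def in_keys_iff minus_poly_mapping.rep_eq)
      then have "u \<in> comm_monomials X" "x \<in> X"
        using less.prems(1) x by (auto simp: comm_monomials_def)
      moreover have "comm_weight u < comm_weight m"
        unfolding m comm_weight_single_add by simp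
      ultimately have "P (Poly_Mapping.single x 1 + u)"
        using less.hyps [of u] zero add by blast
      then show ?thesis
        by (simp only: m [symmetric])
    qed (simp add: zero)
  qed
next
  fix x k and m :: "'a \<Rightarrow>\<^sub>0 nat"
  assume "monomial_divides (comm_monomials X) m (monomial_power (Poly_Mapping.single x 1) k)"
  then obtain u v where "Poly_Mapping.single x k = u + m + v"
    unfolding monomial_divides_def comm_monomial_power by blast
  then have *: "Poly_Mapping.lookup (Poly_Mapping.single x k) y =
      Poly_Mapping.lookup u y + Poly_Mapping.lookup m y + Poly_Mapping.lookup v y" for y
    by (simp add: lookup_add)
  have m: "m = Poly_Mapping.single x (Poly_Mapping.lookup m x)"
  proof (rule poly_mapping_eqI)
    fix y
    show "Poly_Mapping.lookup m y = Poly_Mapping.lookup (Poly_Mapping.single x (Poly_Mapping.lookup m x)) y"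
      using * [of y] by (cases "x = y") (simp_all add: lookup_single)
  qed
  then have "Poly_Mapping.keys m \<subseteq> {x}"
    by (metis keys_single empty_subsetI subset_refl)
  then have "comm_weight m = Poly_Mapping.lookup m x"
    using comm_weight_superset [of "{x}" m] by simp
  with m show "m = monomial_power (Poly_Mapping.single x 1) (comm_weight m)"
    unfolding comm_monomial_power by simp
next
  fix u v :: "'a \<Rightarrow>\<^sub>0 nat"
  assume "u \<in> comm_monomials X" "v \<in> comm_monomials X"
  then show "u + v \<in> comm_monomials X"
    using keys_add [of u v] by (auto simp: comm_monomials_def)
next
  show "comm_weight 0 = 0" by (simp add: comm_weight_def)
qed (simp_all only: comm_weight_single_add, simp_all add: comm_monomials_def)

lemma generated_nc_monomials:
  "generated_monomials X (nc_monomials X) (\<lambda>x. NCMonomial [x]) nc_weight"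
proof
  fix m :: "'a nc_monomial" and P
  assume m: "m \<in> nc_monomials X" and zero: "P 0"
    and add: "\<And>x u. x \<in> X \<Longrightarrow> u \<in> nc_monomials X \<Longrightarrow> P u \<Longrightarrow> P (NCMonomial [x] + u)"
  have "set xs \<subseteq> X \<Longrightarrow> P (NCMonomial xs)" for xs
  proof (induction xs)
    case Nil
    show ?case using zero by (simp add: zero_nc_monomial_def)
  next
    case (Cons x xs)
    then show ?case
      using add [of x "NCMonomial xs"] by (simp add: plus_nc_monomial_def nc_monomials_def)
  qed
  from this [of "letters m"] m show "P m"
    by (simp add: nc_monomials_def)
next
  fix x k and m :: "'a nc_monomial"
  assume "monomial_divides (nc_monomials X) m (monomial_power (NCMonomial [x]) k)"
  then obtain u v where "replicate k x = letters u @ letters m @ letters v"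
    unfolding monomial_divides_def nc_monomial_power by (auto simp: plus_nc_monomial_def)
  then have "set (letters m) \<subseteq> set (replicate k x)"
    by (metis Un_upper1 Un_upper2 order_trans set_append)
  then have "letters m = replicate (length (letters m)) x"
    by (intro replicate_eqI) (auto split: if_splits)
  then show "m = monomial_power (NCMonomial [x]) (nc_weight m)"
    unfolding nc_monomial_power nc_weight_def by (metis nc_monomial.collapse)
qed (auto simp: nc_monomials_def zero_nc_monomial_def plus_nc_monomial_def nc_weight_def)

lemma ex_comm_evaluation:
  fixes c :: "'x \<Rightarrow> 'a::comm_ring_1"
  obtains \<mu> :: "('x \<Rightarrow>\<^sub>0 nat) \<Rightarrow> 'a" where "\<And>u v. \<mu> (u + v) = \<mu> u * \<mu> v"
    "\<And>x. \<mu> (Poly_Mapping.single x 1) = c x"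
proof
  let ?\<mu> = "\<lambda>m. \<Prod>x\<in>Poly_Mapping.keys m. c x ^ Poly_Mapping.lookup m x"
  show "?\<mu> (Poly_Mapping.single x 1) = c x" for x
    by simp
  show "?\<mu> (u + v) = ?\<mu> u * ?\<mu> v" for u v
  proof -
    let ?K = "Poly_Mapping.keys u \<union> Poly_Mapping.keys v"
    have "?\<mu> m = (\<Prod>x\<in>?K. c x ^ Poly_Mapping.lookup m x)" if "Poly_Mapping.keys m \<subseteq> ?K" for m
      using that by (intro prod.mono_neutral_left) (auto simp: in_keys_iff)
    from this [of u] this [of v] this [of "u + v"] show ?thesis
      using keys_add [of u v] by (simp add: lookup_add power_add prod.distrib)
  qed
qed

lemma ex_nc_evaluation:
  fixes c :: "'x \<Rightarrow> 'a::comm_ring_1"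
  obtains \<mu> :: "'x nc_monomial \<Rightarrow> 'a" where "\<And>u v. \<mu> (u + v) = \<mu> u * \<mu> v"
    "\<And>x. \<mu> (NCMonomial [x]) = c x"
  using that [of "\<lambda>m. prod_list (map c (letters m))"] by (simp add: plus_nc_monomial_def)

section \<open>The two presentations\<close>

lemma relations_image:
  assumes hom: "\<And>p q. h (p - q) = h p - h q" "\<And>p q. h (p * q) = h p * h q"
    "\<And>(B :: nat set set) f. h (\<Sum>S\<in>B. f S) = (\<Sum>S\<in>B. h (f S))"
  shows keel_relations_image: "h ` keel_relations D n = keel_relations (\<lambda>S. h (D S)) n"
    and dcp_relations_image: "h ` dcp_relations D n = dcp_relations (\<lambda>S. h (D S)) n"
proof -
  have image: "h ` {f S | S. P S} = {h (f S) | S. P S}"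
    "h ` {g i j | i j. Q i j} = {h (g i j) | i j. Q i j}"
    "h ` {k S T | S T. R S T} = {h (k S T) | S T. R S T}"
    "h ` {e i j k l | i j k l. T i j k l} = {h (e i j k l) | i j k l. T i j k l}"
    for f :: "nat set \<Rightarrow> _" and g :: "nat \<Rightarrow> nat \<Rightarrow> _" and k :: "nat set \<Rightarrow> nat set \<Rightarrow> _"
      and e :: "nat \<Rightarrow> nat \<Rightarrow> nat \<Rightarrow> nat \<Rightarrow> _" and P Q R T
    by blast+
  show "h ` keel_relations D n = keel_relations (\<lambda>S. h (D S)) n"
    by (simp only: keel_relations_def Let_def image_Un image hom)
  show "h ` dcp_relations D n = dcp_relations (\<lambda>S. h (D S)) n"
    by (simp only: dcp_relations_def Let_def image_Un image hom)
qed

text \<open>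
  The values lie in a commutative ring, so commutators are killed along with the relations \<open>R\<close>.
\<close>

lemma (in generated_monomials) square_not_in_ideal:
  fixes \<mu> :: "'m \<Rightarrow> 'a::comm_ring_1"
  assumes \<mu>: "\<And>u v. \<mu> (u + v) = \<mu> u * \<mu> v"
    and R: "\<And>r. r \<in> R \<Longrightarrow> evaluation \<mu> r = 0"
    and K: "K \<subseteq> commutators gen X"
    and x: "\<mu> (var x) * \<mu> (var x) \<noteq> 0"
  shows "gen x * gen x \<notin> ideal (R \<union> K)"
proof
  assume *: "gen x * gen x \<in> ideal (R \<union> K)"
  have "evaluation \<mu> r = 0" if "r \<in> R \<union> K" for r
    using that R K by (auto simp: commutators_def evaluation_diff evaluation_mult [OF \<mu>] mult.commute)
  from evaluation_ideal [OF \<mu> this *] have "evaluation \<mu> (gen x * gen x) = 0" by blast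
  with x show False
    by (simp add: evaluation_mult [OF \<mu>])
qed

text \<open>
  The universal property of the free commutative monoid or the free monoid, for the one target ring \<open>form_ring\<close>: the type
  of the target cannot vary within an assumption of a locale.
\<close>

locale presentation_monomials = generated_monomials X M var wt
  for X :: "nat set set" and M :: "'m::monoid_add set" and var wt +
  assumes ex_evaluation: "\<And>c :: nat set \<Rightarrow> form_ring.
    \<exists>\<mu>. (\<forall>u v. \<mu> (u + v) = \<mu> u * \<mu> v) \<and> (\<forall>x. \<mu> (var x) = c x)"
begin

lemma commutators_closed: "commutators gen X \<subseteq> polynomials M"
  by (auto simp: commutators_def intro!: polynomials_diff polynomials_mult frag_of_closed var_mem)

text \<open>
  The set \<open>K\<close> is empty for the commutative presentation and consists of all commutators of
  generators for the noncommutative one.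
\<close>

lemma no_keel_groebner_basis:
  assumes n: "n \<ge> 4" and X: "X = keel_generators n"
    and K: "K \<subseteq> commutators gen X" "commutators gen X \<subseteq> ideal (keel_relations gen n \<union> K)"
    and ord: "admissible_ordering M ord"
  shows "\<not> (\<exists>G. groebner_basis M ord (ideal (keel_relations gen n \<union> K)) G
    \<and> linear_and_quadratic wt G)"
proof (rule no_linear_and_quadratic_groebner_basis [OF ord])
  let ?R = "keel_relations gen n"
  have "{1, 2} \<in> X"
    using n by (simp add: X keel_generators_def)
  then show "X \<noteq> {}" by blast
  have gen: "gen S \<in> polynomials M" if "S \<in> keel_generators n" for S
    using that by (simp add: frag_of_closed var_mem X)
  have "?R \<subseteq> polynomials M"
    unfolding keel_relations_def Let_def
    by (auto intro!: polynomials_diff polynomials_sum polynomials_mult gen Compl_mem_keel_generators [simplified])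
  with K commutators_closed show RK: "?R \<union> K \<subseteq> polynomials M" by blast
  interpret I: commuting_ideal "polynomials M" "ideal (?R \<union> K)"
    by (rule commuting_ideal [OF RK K(2)])
  interpret rad: commuting_ideal "polynomials M" I.radical
    by (rule I.commuting_ideal_radical)
  show "\<exists>k. gen S ^ k \<in> ideal (?R \<union> K)" if "S \<in> X" for S
  proof -
    have rel: "?R \<subseteq> I.radical"
      using relation_in_ideal I.ideal_subset_radical by blast
    have "gen S \<in> I.radical"
      by (rule rad.keel_vanishing [of n gen S, OF I.radical_semiprime gen rel])
        (use that in \<open>simp_all add: X\<close>)
    then show ?thesis by (simp add: I.radical_def)
  qed
  show "gen S * gen S \<notin> ideal (?R \<union> K)" if "S \<in> X" for S
  proof -
    have S: "S \<subset> {1..n+1}" "S \<noteq> {}"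
      using that by (auto simp: X keel_generators_def)
    obtain c :: "nat set \<Rightarrow> form_ring" where c: "c S * c S \<noteq> 0"
      "\<And>r. r \<in> keel_relations c n \<Longrightarrow> r = 0" "\<And>r. r \<in> dcp_relations c n \<Longrightarrow> r = 0"
      by (rule ex_realization [OF n S]) blast
    obtain \<mu> where \<mu>: "\<And>u v. \<mu> (u + v) = \<mu> u * \<mu> v" "\<And>T. \<mu> (var T) = c T"
      using ex_evaluation [of c] by blast
    show ?thesis
    proof (rule square_not_in_ideal [OF \<mu>(1) _ K(1)])
      have "evaluation \<mu> ` ?R = keel_relations c n"
        using keel_relations_image [of "evaluation \<mu>" gen n]
        by (simp add: evaluation_diff evaluation_mult [OF \<mu>(1)] evaluation_sum \<mu>(2))
      then show "evaluation \<mu> r = 0" if "r \<in> ?R" for r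
        using that c by blast
    qed (simp add: \<mu> c)
  qed
qed

lemma no_dcp_groebner_basis:
  assumes n: "n \<ge> 4" and X: "X = dcp_generators n"
    and K: "K \<subseteq> commutators gen X" "commutators gen X \<subseteq> ideal (dcp_relations gen n \<union> K)"
    and ord: "admissible_ordering M ord"
  shows "\<not> (\<exists>G. groebner_basis M ord (ideal (dcp_relations gen n \<union> K)) G
    \<and> linear_and_quadratic wt G)"
proof (rule no_linear_and_quadratic_groebner_basis [OF ord])
  let ?R = "dcp_relations gen n"
  have "{1, 2} \<in> X"
    using n by (simp add: X dcp_generators_def)
  then show "X \<noteq> {}" by blast
  have gen: "gen S \<in> polynomials M" if "S \<in> dcp_generators n" for S
    using that by (simp add: frag_of_closed var_mem X)
  have "?R \<subseteq> polynomials M"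
    unfolding dcp_relations_def Let_def
    by (auto intro!: polynomials_sum polynomials_mult gen)
  with K commutators_closed show RK: "?R \<union> K \<subseteq> polynomials M" by blast
  interpret I: commuting_ideal "polynomials M" "ideal (?R \<union> K)"
    by (rule commuting_ideal [OF RK K(2)])
  interpret rad: commuting_ideal "polynomials M" I.radical
    by (rule I.commuting_ideal_radical)
  show "\<exists>k. gen S ^ k \<in> ideal (?R \<union> K)" if "S \<in> X" for S
  proof -
    have rel: "?R \<subseteq> I.radical"
      using relation_in_ideal I.ideal_subset_radical by blast
    have "gen S \<in> I.radical"
      by (rule rad.dcp_vanishing [of n gen S, OF I.radical_semiprime gen rel])
        (use that in \<open>simp_all add: X\<close>)
    then show ?thesis by (simp add: I.radical_def)
  qed
  show "gen S * gen S \<notin> ideal (?R \<union> K)" if "S \<in> X" for S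
  proof -
    have S: "S \<subset> {1..n+1}" "S \<noteq> {}"
      using that by (auto simp: X dcp_generators_def)
    obtain c :: "nat set \<Rightarrow> form_ring" where c: "c S * c S \<noteq> 0"
      "\<And>r. r \<in> keel_relations c n \<Longrightarrow> r = 0" "\<And>r. r \<in> dcp_relations c n \<Longrightarrow> r = 0"
      by (rule ex_realization [OF n S]) blast
    obtain \<mu> where \<mu>: "\<And>u v. \<mu> (u + v) = \<mu> u * \<mu> v" "\<And>T. \<mu> (var T) = c T"
      using ex_evaluation [of c] by blast
    show ?thesis
    proof (rule square_not_in_ideal [OF \<mu>(1) _ K(1)])
      have "evaluation \<mu> ` ?R = dcp_relations c n"
        using dcp_relations_image [of "evaluation \<mu>" gen n]
        by (simp add: evaluation_diff evaluation_mult [OF \<mu>(1)] evaluation_sum \<mu>(2))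
      then show "evaluation \<mu> r = 0" if "r \<in> ?R" for r
        using that c by blast
    qed (simp add: \<mu> c)
  qed
qed

end

lemma comm_presentation:
  "presentation_monomials X (comm_monomials X) (\<lambda>x. Poly_Mapping.single x 1) comm_weight"
  by (intro presentation_monomials.intro generated_comm_monomials presentation_monomials_axioms.intro)
    (metis ex_comm_evaluation)

lemma nc_presentation:
  "presentation_monomials X (nc_monomials X) (\<lambda>x. NCMonomial [x]) nc_weight"
  by (intro presentation_monomials.intro generated_nc_monomials presentation_monomials_axioms.intro)
    (metis ex_nc_evaluation)

theorem proposition3p1:
  fixes n :: nat
  assumes "n \<ge> 4"
  shows "(\<forall>ord. admissible_ordering (comm_monomials (keel_generators n)) ord \<longrightarrow>
      \<not> (\<exists>G. groebner_basis (comm_monomials (keel_generators n)) ord (keel_ideal n) G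
            \<and> linear_and_quadratic comm_weight G))
    \<and> (\<forall>ord. admissible_ordering (nc_monomials (keel_generators n)) ord \<longrightarrow>
      \<not> (\<exists>G. groebner_basis (nc_monomials (keel_generators n)) ord (keel_nc_ideal n) G
            \<and> linear_and_quadratic nc_weight G))
    \<and> (\<forall>ord. admissible_ordering (comm_monomials (dcp_generators n)) ord \<longrightarrow>
      \<not> (\<exists>G. groebner_basis (comm_monomials (dcp_generators n)) ord (dcp_ideal n) G
            \<and> linear_and_quadratic comm_weight G))
    \<and> (\<forall>ord. admissible_ordering (nc_monomials (dcp_generators n)) ord \<longrightarrow>
      \<not> (\<exists>G. groebner_basis (nc_monomials (dcp_generators n)) ord (dcp_nc_ideal n) G
            \<and> linear_and_quadratic nc_weight G))"
proof (intro conjI allI impI)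
  have comm: "commutators comm_gen X \<subseteq> {0}" for X :: "nat set set"
    by (auto simp: commutators_def mult.commute)
  have zero: "commutators comm_gen X \<subseteq> two_sided_ideal A R" for X :: "nat set set" and A R
    using comm two_sided_ideal.zero by blast
  have gen: "comm_gen = (\<lambda>x. frag_of (Poly_Mapping.single x 1))"
    by (simp add: comm_gen_def fun_eq_iff)
  fix ord
  show "\<not> (\<exists>G. groebner_basis (comm_monomials (keel_generators n)) ord (keel_ideal n) G
            \<and> linear_and_quadratic comm_weight G)"
    if "admissible_ordering (comm_monomials (keel_generators n)) ord"
    using presentation_monomials.no_keel_groebner_basis [OF comm_presentation assms refl, folded gen,
        OF empty_subsetI zero that]
    by (simp add: keel_ideal_def)
  show "\<not> (\<exists>G. groebner_basis (comm_monomials (dcp_generators n)) ord (dcp_ideal n) G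
            \<and> linear_and_quadratic comm_weight G)"
    if "admissible_ordering (comm_monomials (dcp_generators n)) ord"
    using presentation_monomials.no_dcp_groebner_basis [OF comm_presentation assms refl, folded gen,
        OF empty_subsetI zero that]
    by (simp add: dcp_ideal_def)
next
  have gen: "nc_gen = (\<lambda>x. frag_of (NCMonomial [x]))"
    by (simp add: nc_gen_def fun_eq_iff)
  have relation: "K \<subseteq> two_sided_ideal (polynomials (nc_monomials X)) (R \<union> K)"
    for K R and X :: "nat set set"
    using generated_monomials.relation_in_ideal [OF generated_nc_monomials] by blast
  fix ord
  show "\<not> (\<exists>G. groebner_basis (nc_monomials (keel_generators n)) ord (keel_nc_ideal n) G
            \<and> linear_and_quadratic nc_weight G)"
    if "admissible_ordering (nc_monomials (keel_generators n)) ord"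
    using presentation_monomials.no_keel_groebner_basis [OF nc_presentation assms refl, folded gen,
        OF subset_refl relation that]
    by (simp add: keel_nc_ideal_def)
  show "\<not> (\<exists>G. groebner_basis (nc_monomials (dcp_generators n)) ord (dcp_nc_ideal n) G
            \<and> linear_and_quadratic nc_weight G)"
    if "admissible_ordering (nc_monomials (dcp_generators n)) ord"
    using presentation_monomials.no_dcp_groebner_basis [OF nc_presentation assms refl, folded gen,
        OF subset_refl relation that]
    by (simp add: dcp_nc_ideal_def)
qed

end
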